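(* It is undecidable, given a finite set $\{(u_1,v_1),\ldots,(u_m,v_m)\}\subseteq F(\{a,b\})\times F(\{a,b\})$, whether the semigroup it generates under componentwise concatenation (multiplication in $F(\{a,b\})\times F(\{a,b\})$) is a group. This holds already for $m=48$ (more generally for $m=8(n-1)$ where $n$ is any number of pairs for which Restricted PCP is undecidable).
   Context: $F(\{a,b\})$ denotes the free group on $\{a,b\}$, i.e. reduced words over $\{a,b,a^{-1},b^{-1}\}$. Restricted PCP: given $P=\{(u_1,v_1),\ldots,(u_n,v_n)\}\subseteq\{a,b\}^*\times\{a,b\}^*$ with $n\ge3$, decide whether there is a finite sequence $l_1,\ldots,l_k$ with $2\le l_i\le n-1$ such that $u_1u_{l_1}\cdots u_{l_k}u_n=v_1v_{l_1}\cdots v_{l_k}v_n$; it is known to be undecidable for $n=7$. *)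

theory Defs
  imports "HOL-Algebra.Group" "HOL-Library.Nat_Bijection"
begin

datatype recf =
    Zero
  | Succ
  | Proj nat nat
  | Comp nat recf "recf list"
  | PrRec nat recf recf
  | Mu nat recf

lemmas [mono] = list_all2_mono

inductive eval :: "recf \<Rightarrow> nat list \<Rightarrow> nat \<Rightarrow> bool" where
  eval_Zero: "eval Zero xs 0"
| eval_Succ: "eval Succ [x] (Suc x)"
| eval_Proj: "length xs = n \<Longrightarrow> i < n \<Longrightarrow> eval (Proj n i) xs (xs ! i)"
| eval_Comp: "length xs = n \<Longrightarrow> list_all2 (\<lambda>g y. eval g xs y) gs ys \<Longrightarrow> eval f ys z
              \<Longrightarrow> eval (Comp n f gs) xs z"
| eval_Pr0: "length xs = n \<Longrightarrow> eval f xs y \<Longrightarrow> eval (PrRec n f g) (0 # xs) y"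
| eval_PrS: "eval (PrRec n f g) (x # xs) y \<Longrightarrow> eval g (x # y # xs) z
              \<Longrightarrow> eval (PrRec n f g) (Suc x # xs) z"
| eval_Mu: "length xs = n \<Longrightarrow> eval f (y # xs) 0 \<Longrightarrow> (\<forall>i<y. \<exists>k. eval f (i # xs) (Suc k))
              \<Longrightarrow> eval (Mu n f) xs y"

definition decidable_on :: "('a \<Rightarrow> nat) \<Rightarrow> 'a set \<Rightarrow> ('a \<Rightarrow> bool) \<Rightarrow> bool" where
  "decidable_on enc D Q \<longleftrightarrow> (\<exists>f. \<forall>x\<in>D. eval f [enc x] (if Q x then 1 else 0))"

datatype gen = GA | GB

type_synonym fword = "(bool \<times> gen) list"  (* (True, g) is g^-1, (False, g) is g *)

definition inv_letter :: "bool \<times> gen \<Rightarrow> bool \<times> gen" where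
  "inv_letter x = (\<not> fst x, snd x)"

definition reduced :: "fword \<Rightarrow> bool" where
  "reduced w \<longleftrightarrow> (\<forall>i. Suc i < length w \<longrightarrow> w ! Suc i \<noteq> inv_letter (w ! i))"

fun red_cons :: "bool \<times> gen \<Rightarrow> fword \<Rightarrow> fword" where
  "red_cons x [] = [x]"
| "red_cons x (y # ys) = (if y = inv_letter x then ys else x # y # ys)"

text \<open>Multiplication in the free group on reduced words: concatenate and freely reduce.\<close>
definition fg_mult :: "fword \<Rightarrow> fword \<Rightarrow> fword" where
  "fg_mult u v = foldr red_cons u v"

definition fg2_mult :: "fword \<times> fword \<Rightarrow> fword \<times> fword \<Rightarrow> fword \<times> fword" where
  "fg2_mult p q = (fg_mult (fst p) (fst q), fg_mult (snd p) (snd q))"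

inductive_set gen_semigroup :: "(fword \<times> fword) set \<Rightarrow> (fword \<times> fword) set"
  for G where
  gs_base: "x \<in> G \<Longrightarrow> x \<in> gen_semigroup G"
| gs_mult: "x \<in> gen_semigroup G \<Longrightarrow> y \<in> gen_semigroup G \<Longrightarrow> fg2_mult x y \<in> gen_semigroup G"

definition semigroup_is_group :: "(fword \<times> fword) set \<Rightarrow> bool" where
  "semigroup_is_group S \<longleftrightarrow> (\<exists>e. group \<lparr>carrier = S, monoid.mult = fg2_mult, one = e\<rparr>)"

definition enc_gen :: "gen \<Rightarrow> nat" where
  "enc_gen g = (case g of GA \<Rightarrow> 0 | GB \<Rightarrow> 1)"

definition enc_letter :: "bool \<times> gen \<Rightarrow> nat" where
  "enc_letter x = 2 * (if fst x then 1 else 0) + enc_gen (snd x)"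

definition enc_fg_instance :: "(fword \<times> fword) list \<Rightarrow> nat" where
  "enc_fg_instance P = list_encode
     (map (\<lambda>(u, v). prod_encode (list_encode (map enc_letter u), list_encode (map enc_letter v))) P)"

definition enc_pcp_instance :: "(gen list \<times> gen list) list \<Rightarrow> nat" where
  "enc_pcp_instance P = list_encode
     (map (\<lambda>(u, v). prod_encode (list_encode (map enc_gen u), list_encode (map enc_gen v))) P)"

text \<open>Restricted PCP (0-indexed: pairs P!0 .. P!(n-1); inner indices range over 1..n-2).\<close>
definition rpcp_solvable :: "(gen list \<times> gen list) list \<Rightarrow> bool" where
  "rpcp_solvable P \<longleftrightarrow> (let n = length P in
     \<exists>ls. (\<forall>l\<in>set ls. 1 \<le> l \<and> l \<le> n - 2) \<and>
       fst (P ! 0) @ concat (map (\<lambda>l. fst (P ! l)) ls) @ fst (P ! (n - 1)) =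
       snd (P ! 0) @ concat (map (\<lambda>l. snd (P ! l)) ls) @ snd (P ! (n - 1)))"

definition RPCP_undecidable :: "nat \<Rightarrow> bool" where
  "RPCP_undecidable n \<longleftrightarrow>
     \<not> decidable_on enc_pcp_instance {P. length P = n} rpcp_solvable"

definition fg_instance :: "(fword \<times> fword) list \<Rightarrow> bool" where
  "fg_instance P \<longleftrightarrow> (\<forall>(u, v)\<in>set P. reduced u \<and> reduced v)"

definition group_problem :: "(fword \<times> fword) list \<Rightarrow> bool" where
  "group_problem P \<longleftrightarrow> semigroup_is_group (gen_semigroup (set P))"

definition GROUP_undecidable :: "nat \<Rightarrow> bool" where
  "GROUP_undecidable m \<longleftrightarrow>
     \<not> decidable_on enc_fg_instance {P. fg_instance P \<and> length P = m} group_problem"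

definition GROUP_undecidable_general :: bool where
  "GROUP_undecidable_general \<longleftrightarrow>
     \<not> decidable_on enc_fg_instance {P. fg_instance P} group_problem"

end

theory Submission
  imports Defs Complex_Main
begin

text \<open>An index sequence solves the PCP instance iff the product of the pairs A_i = (u_i, i) along
  it, followed by the pairs B_i = (v_i^-1, i^-1) in reverse order, is trivial up to the border words;
  state letters in the second component, which are visible to affine representations of the free
  group, enforce that all A's precede all B's. Such blocks are placed between six barrier generators
  D_0, ..., D_5, where D_k carries the letters d_k^-1 d_(k+1) in both components (indices mod 6).
  In a trivial product containing a barrier, the way the barrier letters cancel forces, in each
  component separately, more than half of the blocks of types 0, ..., 3 to be trivial; hence some
  block is trivial in both components and yields a solution. The blocks of types 4 and 5 are not
  checked: they give access to inverses of all A_i and B_i, so that every generator, used by the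
  solution or not, occurs in some trivial product.\<close>

section \<open>Free groups as reduced words\<close>

text \<open>The obstacle is that the two components may cancel along different nestings of barriers:
  a segment can vanish in one of them without vanishing in the other, so an innermost cancellation
  proves nothing. A strict majority in each component forces an overlap, and this fixes the number
  of checked types. A cycle of barriers completed inside a segment hides that segment's fate: it was
  booked as a failure (-1) and may still succeed (+1), a correction of 2. The inner cycle earns 4
  and gives back at most 2 for its own type, which just covers the correction. Two more types, one
  for the inverses of the A's and one for those of the B's, make six. The tokens number 4 (n - 2) +
  4 + 6 = 4 n + 2, at most 8 (n - 1) for n \<ge> 3; repetitions fill the rest and leave the
  generated semigroup unchanged. Generators must be output as reduced words. In place of a
  computable free reduction, signs are arranged so that the parts depending on the instance never
  cancel.\<close>

type_synonym 'a word = "(bool \<times> 'a) list"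

definition ilet :: "bool \<times> 'a \<Rightarrow> bool \<times> 'a" where
  "ilet x = (\<not> fst x, snd x)"

fun rcons :: "bool \<times> 'a \<Rightarrow> 'a word \<Rightarrow> 'a word" where
  "rcons x [] = [x]"
| "rcons x (y # ys) = (if y = ilet x then ys else x # y # ys)"

definition nf :: "'a word \<Rightarrow> 'a word" where
  "nf w = foldr rcons w []"

definition irr :: "'a word \<Rightarrow> bool" where
  "irr = successively (\<lambda>x y. y \<noteq> ilet x)"

definition winv :: "'a word \<Rightarrow> 'a word" where
  "winv w = rev (map ilet w)"

lemma ilet_ilet [simp]: "ilet (ilet x) = x"
  by (simp add: ilet_def)

lemma ilet_simps [simp]: "ilet (b, x) = (\<not> b, x)" "fst (ilet y) = (\<not> fst y)" "snd (ilet y) = snd y"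
  by (simp_all add: ilet_def)

lemma irr_Nil [simp]: "irr []"
  by (simp add: irr_def)

lemma irr_Cons: "irr (x # w) \<longleftrightarrow> irr w \<and> (w \<noteq> [] \<longrightarrow> hd w \<noteq> ilet x)"
  by (cases w) (auto simp: irr_def)

lemma irr_append:
  "irr (u @ v) \<longleftrightarrow> irr u \<and> irr v \<and> (u \<noteq> [] \<longrightarrow> v \<noteq> [] \<longrightarrow> hd v \<noteq> ilet (last u))"
  by (auto simp: irr_def successively_append_iff)

lemma irr_rcons: "irr w \<Longrightarrow> irr (rcons x w)"
  by (cases w) (auto simp: irr_Cons)

lemma irr_foldr: "irr w \<Longrightarrow> irr (foldr rcons u w)"
  by (induction u) (auto intro: irr_rcons)

lemma irr_nf [simp]: "irr (nf w)"
  by (simp add: nf_def irr_foldr)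

lemma rcons_ilet: "irr w \<Longrightarrow> rcons x (rcons (ilet x) w) = w"
  by (cases w; cases "tl w") (auto simp: irr_Cons)

text \<open>Van der Waerden's argument: \<open>rcons x\<close> and \<open>rcons (ilet x)\<close> are
  mutually inverse on reduced words, so a cancelled pair of letters acts as the identity.\<close>

lemma foldr_rcons_rcons:
  "irr w \<Longrightarrow> foldr rcons (rcons x u) w = rcons x (foldr rcons u w)"
proof (cases u)
  case (Cons y ys)
  assume "irr w"
  then have "rcons x (rcons (ilet x) (foldr rcons ys w)) = foldr rcons ys w"
    by (intro rcons_ilet irr_foldr)
  then show ?thesis using Cons by auto
qed simp

lemma foldr_rcons_nf: "irr w \<Longrightarrow> foldr rcons (nf u) w = foldr rcons u w"
proof (induction u)
  case (Cons x u)
  have "nf (x # u) = rcons x (nf u)" by (simp add: nf_def)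
  then show ?case using Cons by (simp add: foldr_rcons_rcons)
qed (simp add: nf_def)

lemma nf_append: "nf (u @ v) = foldr rcons u (nf v)"
  by (simp add: nf_def)

lemma nf_irr: "irr w \<Longrightarrow> nf w = w"
proof (induction w)
  case (Cons x w)
  then have "nf (x # w) = rcons x w"
    using Cons by (simp add: nf_def irr_Cons)
  also have "\<dots> = x # w" using Cons.prems by (cases w) (auto simp: irr_Cons)
  finally show ?case .
qed (simp add: nf_def)

lemma nf_append_nf: "nf (nf u @ nf v) = nf (u @ v)"
  by (simp add: nf_append foldr_rcons_nf nf_irr)

text \<open>The way to define functions on the free group: whatever survives cancellation of a pair
  and depends on a tail only through its own value factors through \<open>nf\<close>. Applied to
  \<open>dec\<close>, \<open>phi\<close> and \<open>act\<close>.\<close>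

lemma nf_invariant:
  assumes c: "\<And>x w. h (x # ilet x # w) = h w"
    and s: "\<And>x w w'. h w = h w' \<Longrightarrow> h (x # w) = h (x # w')"
  shows "h (nf w) = h w"
proof (induction w)
  case (Cons x w)
  have r: "h (rcons x u) = h (x # u)" for u
    using c by (cases u) auto
  have "nf (x # w) = rcons x (nf w)" by (simp add: nf_def)
  then show ?case using r s[OF Cons.IH] by simp
qed (simp add: nf_def)

lemma winv_append: "winv (u @ v) = winv v @ winv u"
  by (simp add: winv_def)

lemma winv_Cons: "winv (x # w) = winv w @ [ilet x]"
  by (simp add: winv_def)

lemma winv_simps [simp]: "winv [] = []" "winv [x] = [ilet x]" "winv w = [] \<longleftrightarrow> w = []"
  by (simp_all add: winv_def)

lemma nf_cancel: "nf (x # ilet x # w) = nf w"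
  by (simp add: nf_def rcons_ilet irr_foldr)

lemma nf_winv_append: "nf (winv w @ w) = []"
proof (induction w rule: rev_induct)
  case (snoc x w)
  have "nf (winv (w @ [x]) @ w @ [x]) = nf (ilet x # (winv w @ w) @ [x])"
    by (simp add: winv_def)
  also have "\<dots> = rcons (ilet x) (nf ((winv w @ w) @ [x]))"
    by (simp add: nf_def)
  also have "nf ((winv w @ w) @ [x]) = nf ([] @ [x])"
    using nf_append_nf[of "winv w @ w" "[x]"] snoc nf_append_nf[of "[]" "[x]"] by (simp add: nf_def)
  finally show ?case by (simp add: nf_def)
qed (simp add: nf_def)

section \<open>The free group as a type of class \<open>group_add\<close>, written
  additively\<close>

typedef 'a fgrp = "{w :: 'a word. irr w}"
  by (rule exI[of _ "[]"]) simp

definition mk :: "'a word \<Rightarrow> 'a fgrp" where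
  "mk w = Abs_fgrp (nf w)"

lemma Rep_mk [simp]: "Rep_fgrp (mk w) = nf w"
  by (simp add: mk_def Abs_fgrp_inverse)

lemma mk_eq_iff: "mk u = mk v \<longleftrightarrow> nf u = nf v"
  by (metis Rep_mk mk_def)

lemma mk_Rep [simp]: "mk (Rep_fgrp x) = x"
  by (metis Rep_fgrp Rep_fgrp_inject Rep_mk mem_Collect_eq nf_irr)

instantiation fgrp :: (type) group_add
begin

definition "0 = mk []"
definition "x + y = mk (Rep_fgrp x @ Rep_fgrp y)"
definition "- x = mk (winv (Rep_fgrp x))"
definition "x - (y :: 'a fgrp) = x + - y"

lemma mk_append: "mk (u @ v) = mk u + mk v"
  by (simp add: plus_fgrp_def mk_eq_iff nf_append_nf)

instance
proof
  fix x y z :: "'a fgrp"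
  have "mk ((Rep_fgrp x @ Rep_fgrp y) @ Rep_fgrp z) = mk (Rep_fgrp x @ (Rep_fgrp y @ Rep_fgrp z))"
    by simp
  then show "x + y + z = x + (y + z)"
    by (simp only: mk_append mk_Rep)
  show "0 + x = x" "x + 0 = x"
    by (simp_all add: zero_fgrp_def flip: mk_append) (metis append_Nil append_Nil2 mk_Rep
        mk_append)+
  have "mk (winv (Rep_fgrp x) @ Rep_fgrp x) = 0"
    by (simp add: zero_fgrp_def mk_eq_iff nf_winv_append) (simp add: nf_def)
  then show "- x + x = 0"
    by (simp only: mk_append mk_Rep uminus_fgrp_def)
  show "x + - y = x - y" by (simp add: minus_fgrp_def)
qed

end

lemma mk_Nil [simp]: "mk [] = 0"
  by (simp add: zero_fgrp_def)

lemma mk_Cons: "mk (x # w) = mk [x] + mk w"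
  using mk_append[of "[x]" w] by simp

lemma mk_eq_0_iff: "mk w = 0 \<longleftrightarrow> nf w = []"
  unfolding mk_Nil[symmetric] mk_eq_iff by (simp add: nf_def)

lemma mk_winv: "mk (winv w) = - mk w"
proof -
  have "mk (winv w @ w) = 0"
    by (simp add: mk_eq_0_iff nf_winv_append)
  then show ?thesis by (simp add: mk_append eq_neg_iff_add_eq_0)
qed

lemma mk_True: "mk [(True, x)] = - mk [(False, x)]"
  using mk_winv[of "[(False, x)]"] by (simp add: winv_def)

lemma mk_nf [simp]: "mk (nf w) = mk w"
  by (simp add: mk_eq_iff nf_irr)

lemma irr_pos_word: "(\<And>x. x \<in> set w \<Longrightarrow> fst x = b) \<Longrightarrow> irr w"
proof (induction w)
  case (Cons x w)
  have "hd w \<noteq> ilet x" if "w \<noteq> []"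
    using Cons.prems[of x] Cons.prems[of "hd w"] that by auto
  then show ?case using Cons by (simp add: irr_Cons)
qed simp

text \<open>Positive words are reduced as they stand, so the free monoid embeds in the free group.
  This turns trivial products back into equalities of words.\<close>

lemma mk_pos_word_inject:
  assumes "inj f" and "mk (map (\<lambda>x. (False, f x)) u) = mk (map (\<lambda>x. (False, f x)) v)"
  shows "u = v"
proof -
  have irr: "irr (map (\<lambda>x. (False, f x)) w)" for w
    by (rule irr_pos_word[of _ False]) auto
  have "map (\<lambda>x. (False, f x)) u = map (\<lambda>x. (False, f x)) v"
    using assms(2) by (simp add: mk_eq_iff nf_irr irr)
  then show ?thesis
    using assms(1) by (auto intro: map_injective simp: inj_def)
qed

section \<open>Embedding a free group of infinite rank\<close>

definition apow :: "int \<Rightarrow> fword" where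
  "apow m = replicate (nat m) (False, GA) @ replicate (nat (- m)) (True, GA)"

definition yw :: "int \<Rightarrow> fword" where
  "yw m = apow m @ [(False, GB)] @ apow (1 - m)"

definition phi :: "int word \<Rightarrow> fword" where
  "phi w = concat (map (\<lambda>(b, m). if b then winv (yw m) else yw m) w)"

text \<open>The words yw m are the Schreier generators of the kernel of a \<mapsto> 1, b \<mapsto> -1, and dec is the
  corresponding rewriting process, started at the coset m. Since yw 1 = ab and yw 0 = ba, the images
  of positive words in these two letters are reduced as they stand.\<close>
fun dec :: "int \<Rightarrow> fword \<Rightarrow> int word" where
  "dec m [] = []"
| "dec m ((False, GA) # w) = dec (m + 1) w"
| "dec m ((True, GA) # w) = dec (m - 1) w"
| "dec m ((False, GB) # w) = (False, m) # dec (m - 1) w"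
| "dec m ((True, GB) # w) = (True, m + 1) # dec (m + 1) w"

lemma dec_replicate:
  "dec m (replicate k (False, GA) @ w) = dec (m + int k) w"
  "dec m (replicate k (True, GA) @ w) = dec (m - int k) w"
  by (induction k arbitrary: m) (auto simp: algebra_simps)

lemma dec_apow: "dec m (apow k @ w) = dec (m + k) w"
  by (cases "k \<ge> 0") (auto simp: apow_def dec_replicate)

lemma winv_apow: "winv (apow k) = apow (- k)"
  by (cases "k \<ge> 0") (auto simp: apow_def winv_def)

lemma dec_phi: "dec 0 (phi w) = w"
proof -
  have [simp]: "dec 0 (yw k @ v) = (False, k) # dec 0 v"
    "dec 0 (winv (yw k) @ v) = (True, k) # dec 0 v" for k v
    by (simp_all add: yw_def winv_append winv_Cons winv_apow dec_apow)
  show ?thesis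
    by (induction w) (auto simp: phi_def)
qed

lemma phi_append: "phi (u @ v) = phi u @ phi v"
  by (simp add: phi_def)

text \<open>Since \<open>dec\<close> inverts \<open>phi\<close> on words, it remains that decoding
  respects cancellation. A letter moves the coset, so the invariant is the function of all starting
  cosets \<open>m\<close> at once.\<close>

lemma mk_phi_eq_0_iff: "mk (phi w) = 0 \<longleftrightarrow> mk w = 0"
proof
  assume "mk (phi w) = 0"
  then have n: "nf (phi w) = []" by (simp add: mk_eq_0_iff)
  have "(\<lambda>m. mk (dec m (nf (phi w)))) = (\<lambda>m. mk (dec m (phi w)))"
  proof (rule nf_invariant)
    fix x :: "bool \<times> gen" and w w' :: fword
    obtain b g where x: "x = (b, g)" by (cases x)
    have c: "mk ((True, k) # (False, k) # v) = mk v" "mk ((False, k) # (True, k) # v) = mk v"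
      for k :: int and v
      using nf_cancel[of "(True, k)" v] nf_cancel[of "(False, k)" v] by (simp_all add: mk_eq_iff)
    show "(\<lambda>m. mk (dec m (x # ilet x # w))) = (\<lambda>m. mk (dec m w))"
      by (cases b; cases g) (auto simp: x c)
    assume "(\<lambda>m. mk (dec m w)) = (\<lambda>m. mk (dec m w'))"
    then have "\<And>m. mk (dec m w) = mk (dec m w')" by meson
    then show "(\<lambda>m. mk (dec m (x # w))) = (\<lambda>m. mk (dec m (x # w')))"
      by (cases b; cases g) (auto simp: x mk_Cons[of _ "dec _ _"])
  qed
  then have "mk (dec 0 (phi w)) = mk (dec 0 [])" by (metis n)
  then show "mk w = 0" by (simp add: dec_phi)
next
  assume "mk w = 0"
  have ph: "mk (phi (x # w)) = (if fst x then - mk (yw (snd x)) else mk (yw (snd x))) + mk (phi w)"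
    for x w by (auto simp: phi_def mk_append mk_winv split: prod.splits)
  have "mk (phi (nf w)) = mk (phi w)"
    by (rule nf_invariant) (auto simp: ph add.assoc[symmetric])
  with \<open>mk w = 0\<close> show "mk (phi w) = 0"
    by (simp add: mk_eq_0_iff[of w] phi_def)
qed

section \<open>Counting trivial segments\<close>

definition next_type :: "nat \<Rightarrow> nat" where
  "next_type k = (k + 1) mod 6"

definition check :: "nat \<Rightarrow> int" where
  "check k = (if k < 4 then 1 else 0)"

definition barrier :: "nat \<Rightarrow> int" where
  "barrier k = - int k - 1"

text \<open>Number of check types strictly between a and k in the cyclic order on {0..5}.\<close>
definition checks_between :: "nat \<Rightarrow> nat \<Rightarrow> int" where
  "checks_between a k = (if a < k then 0 else 4) + int (min k 4) - int (min (a + 1) 4)"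

definition barrier_free :: "int word \<Rightarrow> bool" where
  "barrier_free w \<longleftrightarrow> (\<forall>x\<in>set w. 0 \<le> snd x)"

text \<open>Item lists are stored with the latest item first; an item consists of the index of a barrier
  generator and the barrier-free word following it. The argument j of the weight is the index of the
  next barrier generator, and ex j is the barrier-free word preceding its barrier letters.\<close>
fun weight :: "(nat \<Rightarrow> int word) \<Rightarrow> (nat \<times> int word) list \<Rightarrow> nat \<Rightarrow> int" where
  "weight ex [] j = 0"
| "weight ex ((i, M) # r) j =
     weight ex r i + (if j = next_type i \<and> mk (M @ ex j) = 0 then check (next_type i) else - check
         (next_type i))"

fun item_word :: "(nat \<Rightarrow> int word) \<Rightarrow> int word \<Rightarrow> (nat \<times> int word) list \<Rightarrow> int word" where
  "item_word ex m0 [] = m0"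
| "item_word ex m0 ((i, M) # r) = item_word ex m0 r @ ex i @ [(True, barrier i), (False, barrier
    (next_type i))] @ M"

fun frame_word :: "(nat \<times> nat \<times> int word) list \<Rightarrow> int word" where
  "frame_word [] = []"
| "frame_word ((a, k, h) # r) = frame_word r @ [(True, barrier a), (False, barrier k)] @ h"

fun valid_frames :: "(nat \<times> nat \<times> int word) list \<Rightarrow> bool" where
  "valid_frames [] = True"
| "valid_frames ((a, k, h) # r) \<longleftrightarrow> a < 6 \<and> k < 6 \<and> a \<noteq> k \<and> barrier_free h \<and> irr h \<and> valid_frames r \<and>
     (case r of [] \<Rightarrow> True | (a', k', h') # _ \<Rightarrow> \<not> (h' = [] \<and> k' = a))"

text \<open>The segments absorbed between \<open>d_a\<close> and \<open>d_k\<close> count as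
  successes; the open one after \<open>d_k\<close> is charged as a failure until some barrier closes
  it.\<close>

fun frame_sum :: "(nat \<times> nat \<times> int word) list \<Rightarrow> int" where
  "frame_sum [] = 0"
| "frame_sum ((a, k, h) # r) = frame_sum r + checks_between a k - check k"

section \<open>Reduced words with barriers as stacks of frames\<close>

lemma barrier_free_simps [simp]: "barrier_free []" "barrier_free (x # w) \<longleftrightarrow> 0 \<le> snd x \<and>
    barrier_free w" "barrier_free (u @ v) \<longleftrightarrow> barrier_free u \<and> barrier_free v"
  by (auto simp: barrier_free_def)

lemma set_rcons: "set (rcons x w) \<subseteq> insert x (set w)"
  by (cases w) auto

lemma set_nf: "set (nf w) \<subseteq> set w"
  by (induction w) (use set_rcons in \<open>fastforce simp: nf_def\<close>)+

lemma barrier_free_nf: "barrier_free w \<Longrightarrow> barrier_free (nf w)"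
  using set_nf[of w] by (auto simp: barrier_free_def)

lemma barrier_neg: "barrier k < 0"
  by (simp add: barrier_def)

lemma barrier_inject [simp]: "barrier k = barrier l \<longleftrightarrow> k = l"
  by (simp add: barrier_def)

text \<open>Barrier letters have negative index and segment letters do not, so only adjacent barrier
  letters could cancel, which \<open>valid_frames\<close> excludes. Hence a trivial word has an
  empty stack.\<close>

lemma irr_frame_word:
  assumes "irr h0" "barrier_free h0" "valid_frames fs"
  shows "irr (h0 @ frame_word fs)"
  using assms(3)
proof (induction fs)
  case (Cons f r)
  obtain a k h where f: "f = (a, k, h)" by (cases f)
  have "barrier_free h" "irr h" "a \<noteq> k" and IH: "irr (h0 @ frame_word r)" using Cons by (auto
      simp: f)
  have 1: "irr ([(True, barrier a), (False, barrier k)] @ h)"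
    using \<open>barrier_free h\<close> \<open>irr h\<close> \<open>a \<noteq> k\<close> barrier_neg[of k] by (cases h) (auto simp: irr_Cons)
  have 2: "(True, barrier a) \<noteq> ilet (last (h0 @ frame_word r))" if ne: "h0 @ frame_word r \<noteq> []"
  proof (cases r)
    case Nil
    then have "0 \<le> snd (last h0)" using assms(2) ne by (auto simp: barrier_free_def)
    then show ?thesis using barrier_neg[of a] ne Nil by (metis append_Nil2 frame_word.simps(1)
        ilet_simps(3) not_le snd_conv)
  next
    case (Cons f' r')
    obtain a' k' h' where f': "f' = (a', k', h')" by (cases f')
    show ?thesis
    proof (cases "h' = []")
      case True
      then show ?thesis using Cons.prems Cons \<open>valid_frames (f # r)\<close> by (auto simp: f f')
    next
      case False
      then have "0 \<le> snd (last h')" using \<open>valid_frames (f # r)\<close> Cons by (auto simp: f f'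
          barrier_free_def)
      then show ?thesis using barrier_neg[of a] False Cons
        by (metis (no_types, lifting) append_is_Nil_conv f' frame_word.simps(2) ilet_simps(3)
            last_appendR not_le snd_conv)
    qed
  qed
  have "irr ((h0 @ frame_word r) @ [(True, barrier a), (False, barrier k)] @ h)"
    unfolding irr_append[of "h0 @ frame_word r"] using IH 1 2 by simp
  then show ?case by (simp add: f)
qed (use assms in simp)

lemma checks_between_same: "i < 6 \<Longrightarrow> checks_between i (next_type i) = 0"
  by (auto simp: checks_between_def next_type_def check_def mod_Suc)

lemma checks_between_step:
  assumes "a < 6" "k < 6" "a \<noteq> k"
  shows "next_type k \<noteq> a \<Longrightarrow> checks_between a (next_type k) = checks_between a k + check k"
    and "next_type k = a \<Longrightarrow> checks_between a k + check k = 4 - check a"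
  using assms by (auto simp: checks_between_def next_type_def check_def mod_Suc min_def split:
      if_splits)

lemma next_type_less: "next_type k < 6"
  by (simp add: next_type_def)

lemma next_type_neq: "k < 6 \<Longrightarrow> k \<noteq> next_type k"
  by (simp add: next_type_def mod_Suc)

text \<open>The third clause anticipates the next barrier: if it closes the top segment, as
  expressed by \<open>cl\<close>, the charge \<open>- check k\<close> turns into
  \<open>+ check k\<close>. The second clause records the gain of a completed cycle once the stack
  is empty.\<close>

definition stack_bound where
  "stack_bound fs W ne cl \<longleftrightarrow> frame_sum fs \<le> W \<and> (fs = [] \<longrightarrow> ne \<longrightarrow> 2 \<le> W) \<and>
     (\<forall>a k h r. fs = (a, k, h) # r \<longrightarrow> cl k h \<longrightarrow> frame_sum r + checks_between a k + check k \<le> W)"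

text \<open>Scanning from the left, the reduced form is kept as a stack of frames; a frame is closed
  when its barrier letters cancel, and by then it has gained weight at least 2.\<close>
lemma stack_invariant:
  assumes "\<forall>(i, M)\<in>set its. i < 6 \<and> barrier_free M" and "barrier_free m0" and ex: "\<And>j.
      barrier_free (ex j)"
  shows "\<exists>h0 fs. irr h0 \<and> barrier_free h0 \<and> valid_frames fs \<and> mk (item_word ex m0 its) = mk (h0 @
      frame_word fs) \<and>
    (\<forall>j. stack_bound fs (weight ex its j) (its \<noteq> []) (\<lambda>k h. k = j \<and> mk (h @ ex j) = 0))"
  using assms(1)
proof (induction its)
  case Nil
  have "stack_bound [] 0 False c" for c by (simp add: stack_bound_def)
  then show ?case using assms(2)
    by (intro exI[of _ "nf m0"] exI[of _ "[]"]) (auto simp: barrier_free_nf)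
next
  case (Cons x its)
  obtain i M where x: "x = (i, M)" by (cases x)
  have i: "i < 6" and M: "barrier_free M" using Cons.prems by (auto simp: x)
  obtain h0 fs where h0: "irr h0" "barrier_free h0" and fs: "valid_frames fs"
    and w: "mk (item_word ex m0 its) = mk (h0 @ frame_word fs)"
    and inv: "\<And>j. stack_bound fs (weight ex its j) (its \<noteq> []) (\<lambda>k h. k = j \<and> mk (h @ ex j) = 0)"
    using Cons by auto
  let ?W = "weight ex its i"
  have W1: "frame_sum fs \<le> ?W" using inv[of i] by (simp add: stack_bound_def)
  have item_word: "mk (item_word ex m0 (x # its)) =
      mk (h0 @ frame_word fs) + mk (ex i) + (- mk [(False, barrier i)]) + mk [(False, barrier
          (next_type i))] + mk M"
    by (simp add: x mk_append w mk_Cons[of _ "_ # _"] mk_Cons[of _ M] mk_True add.assoc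
        del: add_uminus_conv_diff)
  have low: "?W - check (next_type i) \<le> weight ex (x # its) j" for j
    by (auto simp: x check_def)
  \<comment> \<open>Common end of three cases: the new barrier either opens a frame of its own
    (\<open>a = i\<close>) or prolongs the popped top frame, keeping that frame's opening letter
    \<open>a\<close>.\<close>
  have push: "\<exists>h0 fs. irr h0 \<and> barrier_free h0 \<and> valid_frames fs \<and> mk (item_word ex m0 (x # its))
      = mk (h0 @ frame_word fs) \<and>
      (\<forall>j. stack_bound fs (weight ex (x # its) j) (x # its \<noteq> []) (\<lambda>k h. k = j \<and> mk (h @ ex j) = 0))"
    if "irr h0'" "barrier_free h0'" "valid_frames fs'" "a < 6" "a \<noteq> next_type i"
      "case fs' of [] \<Rightarrow> True | (a', k', h') # _ \<Rightarrow> \<not> (h' = [] \<and> k' = a)"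
      "frame_sum fs' + checks_between a (next_type i) \<le> ?W"
      "mk (h0 @ frame_word fs) + mk (ex i) + (- mk [(False, barrier i)]) = mk (h0' @ frame_word
          fs') + (- mk [(False, barrier a)])"
    for h0' fs' a
  proof (intro exI[of _ h0'] exI[of _ "(a, next_type i, nf M) # fs'"] conjI allI)
    show "mk (item_word ex m0 (x # its)) = mk (h0' @ frame_word ((a, next_type i, nf M) # fs'))"
      unfolding item_word that(8)
      by (simp add: mk_append mk_Cons[of _ "_ # _"] mk_Cons[of _ "nf _"] mk_True add.assoc
          del: add_uminus_conv_diff)
    fix j
    have "frame_sum fs' + checks_between a (next_type i) + check (next_type i) \<le> weight ex (x #
        its) j" if "next_type i = j" "mk (nf M @ ex j) = 0"
      using that \<open>frame_sum fs' + checks_between a (next_type i) \<le> ?W\<close> by (simp add: x mk_append)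
    then show "stack_bound ((a, next_type i, nf M) # fs') (weight ex (x # its) j) (x # its \<noteq> [])
        (\<lambda>k h. k = j \<and> mk (h @ ex j) = 0)"
      using that(7) low[of j] by (auto simp: stack_bound_def)
  qed (use that M next_type_less in \<open>auto simp: barrier_free_nf\<close>)
  show ?case
  proof (cases fs)
    case Nil
    show ?thesis
      by (rule push[of "nf (h0 @ ex i)" "[]" i])
        (use Nil i h0 ex next_type_neq W1 checks_between_same in \<open>auto simp: barrier_free_nf
            mk_append\<close>)
  next
    case (Cons f r)
    obtain a k h where f: "f = (a, k, h)" by (cases f)
    have v: "a < 6" "k < 6" "a \<noteq> k" "barrier_free h" "irr h" "valid_frames r"
      and rr: "case r of [] \<Rightarrow> True | (a', k', h') # _ \<Rightarrow> \<not> (h' = [] \<and> k' = a)"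
      using fs by (auto simp: Cons f)
    show ?thesis
    proof (cases "k = i \<and> mk (h @ ex i) = 0")
      case False
      show ?thesis
      proof (rule push[of h0 "(a, k, nf (h @ ex i)) # r" i])
        show "valid_frames ((a, k, nf (h @ ex i)) # r)" using v rr ex by (simp add: barrier_free_nf)
      qed (use Cons i h0 ex next_type_neq W1 checks_between_same False in
          \<open>auto simp: f barrier_free_nf mk_append simp flip: mk_eq_0_iff simp: mk_Cons[of _ "_ #
              _"] mk_Cons[of _ "nf _"]
             mk_Cons[of _ h] add.assoc\<close>)
    next
      case True
      have W2: "frame_sum r + checks_between a k + check k \<le> ?W"
        using inv[of i] True by (auto simp: stack_bound_def Cons f)
      have he: "mk h + mk (ex i) = 0" using True by (simp add: mk_append)
      have he': "mk h + (mk (ex i) + z) = z" for z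
        using he by (simp flip: add.assoc)
      \<comment> \<open>\<open>d_k\<close> meets \<open>d_i^-1\<close> across a trivial segment,
        which leaves the opening letter \<open>d_a^-1\<close> of the popped frame on top.\<close>
      have eq: "mk (h0 @ frame_word fs) + mk (ex i) + (- mk [(False, barrier i)]) =
          mk (h0 @ frame_word r) + (- mk [(False, barrier a)])"
        using True by (simp add: Cons f mk_append mk_Cons[of _ "_ # _"] mk_Cons[of _ h] mk_True
            add.assoc he' del: add_uminus_conv_diff)
      show ?thesis
      proof (cases "next_type k = a")
        case False
        show ?thesis
          by (rule push[of h0 r a]) (use False True v rr h0 eq W2 checks_between_step(1)[of a k]
              in auto)
      next
        case nk: True
        then have nxi: "next_type i = a" using True by simp
        \<comment> \<open>The completed cycle has earned \<open>4 - check a\<close>, and the segment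
          \<open>M\<close> after it costs at most \<open>check a\<close>: a net gain of at least
          2.\<close>
        have W3: "frame_sum r + 2 \<le> weight ex (x # its) j" for j
          using low[of j] W2 checks_between_step(2)[OF v(1-3) nk] nxi by (simp add: check_def
              split: if_splits)
        have wd': "mk (item_word ex m0 (x # its)) = mk (h0 @ frame_word r) + mk M"
          unfolding item_word eq by (simp add: nxi add.assoc)
        show ?thesis
        proof (cases r)
          case Nil
          show ?thesis
            by (intro exI[of _ "nf (h0 @ M)"] exI[of _ "[]"])
              (use h0 M W3 Nil wd' in \<open>auto simp: barrier_free_nf stack_bound_def mk_append
                 intro: order_trans[of 0 2]\<close>)
        next
          case (Cons g r2)
          obtain a2 k2 h2 where g: "g = (a2, k2, h2)" by (cases g)
          \<comment> \<open>The exposed segment \<open>h2\<close> was charged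
            \<open>check k2\<close> and may still close as \<open>h2 @ M\<close>; replacing -1 by +1
            costs 2, which the cycle has earned.\<close>
          have "frame_sum r2 + checks_between a2 k2 + check k2 \<le> weight ex (x # its) j" for j
            using W3[of j] by (auto simp: Cons g check_def split: if_splits)
          moreover have "frame_sum r \<le> weight ex (x # its) j" for j using W3[of j] by simp
          ultimately show ?thesis
            by (intro exI[of _ h0] exI[of _ "(a2, k2, nf (h2 @ M)) # r2"])
              (use h0 v M wd' in \<open>auto simp: Cons g barrier_free_nf stack_bound_def mk_append
                 mk_Cons[of _ "_ # _"] mk_Cons[of _ "nf _"] mk_Cons[of _ h2] add.assoc\<close>)
        qed
      qed
    qed
  qed
qed

lemma weight_ge_2:
  assumes "\<forall>(i, M)\<in>set its. i < 6 \<and> barrier_free M" and "barrier_free m0" and "\<And>j. barrier_free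
      (ex j)"
    and "its \<noteq> []" and "mk (item_word ex m0 its) = 0"
  shows "2 \<le> weight ex its j"
proof -
  obtain h0 fs where h: "irr h0" "barrier_free h0" "valid_frames fs" "mk (item_word ex m0 its) =
      mk (h0 @ frame_word fs)"
    and inv: "\<And>j. stack_bound fs (weight ex its j) (its \<noteq> []) (\<lambda>k h. k = j \<and> mk (h @ ex j) = 0)"
    using stack_invariant[OF assms(1,2), of ex] assms(3) by blast
  have "h0 @ frame_word fs = []"
    using h irr_frame_word[OF h(1-3)] assms(5) by (metis mk_eq_0_iff nf_irr)
  then have "fs = []" by (cases fs rule: frame_word.cases) auto
  then show ?thesis using inv[of j] assms(4) by (simp add: stack_bound_def)
qed

section \<open>Overlap of the two components\<close>

fun common :: "(nat \<Rightarrow> int word) \<Rightarrow> (nat \<Rightarrow> int word) \<Rightarrow> (nat \<times> int word \<times> int word) list \<Rightarrow> nat \<Rightarrow> bool"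
  where
  "common e1 e2 [] j = False"
| "common e1 e2 ((i, M, N) # r) j \<longleftrightarrow> common e1 e2 r i \<or>
     j = next_type i \<and> next_type i < 4 \<and> mk (M @ e1 j) = 0 \<and> mk (N @ e2 j) = 0"

text \<open>A checked segment that is not a success in both components contributes 1 - 1 or -1 - 1,
  an unchecked one 0.\<close>

lemma weight_sum_le:
  "\<not> common e1 e2 its j \<Longrightarrow>
     weight e1 (map (\<lambda>(i, M, N). (i, M)) its) j + weight e2 (map (\<lambda>(i, M, N). (i, N)) its) j \<le> 0"
proof (induction its arbitrary: j)
  case (Cons x its)
  then obtain i M N where x: "x = (i, M, N)" by (cases x)
  show ?case using Cons.IH[of i] Cons.prems by (auto simp: x check_def)
qed simp

lemma ex_common:
  assumes "\<forall>(i, M, N)\<in>set its. i < 6 \<and> barrier_free M \<and> barrier_free N" and "barrier_free m1"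
      "barrier_free m2"
    and "\<And>j. barrier_free (e1 j)" "\<And>j. barrier_free (e2 j)" and "its \<noteq> []"
    and "mk (item_word e1 m1 (map (\<lambda>(i, M, N). (i, M)) its)) = 0"
    and "mk (item_word e2 m2 (map (\<lambda>(i, M, N). (i, N)) its)) = 0"
  shows "common e1 e2 its j"
proof (rule ccontr)
  assume "\<not> common e1 e2 its j"
  moreover have "2 \<le> weight e1 (map (\<lambda>(i, M, N). (i, M)) its) j"
    by (rule weight_ge_2[of _ m1]) (use assms in fastforce)+
  moreover have "2 \<le> weight e2 (map (\<lambda>(i, M, N). (i, N)) its) j"
    by (rule weight_ge_2[of _ m2]) (use assms in fastforce)+
  ultimately show False using weight_sum_le[of e1 e2 its j] by simp
qed

section \<open>Computable functions\<close>

definition computable :: "(nat \<Rightarrow> nat) \<Rightarrow> bool" where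
  "computable F \<longleftrightarrow> (\<exists>f. \<forall>x. eval f [x] (F x))"

definition computable2 :: "(nat \<Rightarrow> nat \<Rightarrow> nat) \<Rightarrow> bool" where
  "computable2 H \<longleftrightarrow> (\<exists>f. \<forall>x y. eval f [x, y] (H x y))"

lemma eval_Proj':
  "eval (Proj 1 0) [x] x" "eval (Proj 2 0) [x, y] x" "eval (Proj 2 1) [x, y] y"
  "eval (Proj 3 1) [x, y, z] y" "eval (Proj 3 2) [x, y, z] z"
  using eval_Proj[of "[x]" 1 0] eval_Proj[of "[x, y]" 2 0] eval_Proj[of "[x, y]" 2 1]
    eval_Proj[of "[x, y, z]" 3 1] eval_Proj[of "[x, y, z]" 3 2]
  by simp_all

lemma eval_Comp1:
  "length xs = n \<Longrightarrow> eval g xs y \<Longrightarrow> eval f [y] z \<Longrightarrow> eval (Comp n f [g]) xs z"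
  by (rule eval_Comp[of _ _ _ "[y]"]) auto

lemma eval_Comp2:
  "length xs = n \<Longrightarrow> eval g xs y \<Longrightarrow> eval h xs y' \<Longrightarrow> eval f [y, y'] z \<Longrightarrow>
     eval (Comp n f [g, h]) xs z"
  by (rule eval_Comp[of _ _ _ "[y, y']"]) auto

lemma computable_id: "computable (\<lambda>x. x)"
  unfolding computable_def using eval_Proj'(1) by blast

lemma computable_Suc: "computable Suc"
  unfolding computable_def using eval_Succ by blast

lemma computable_comp: "computable F \<Longrightarrow> computable G \<Longrightarrow> computable (\<lambda>x. F (G x))"
  unfolding computable_def by (elim exE, intro exI allI, rule eval_Comp1) auto

lemma computable_const: "computable (\<lambda>x. c)"
proof (induction c)
  case 0
  show ?case unfolding computable_def using eval_Zero by blast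
next
  case (Suc c)
  then show ?case using computable_comp[OF computable_Suc] by blast
qed

lemma computable2_fst: "computable2 (\<lambda>x y. x)" and computable2_snd: "computable2 (\<lambda>x y. y)"
  unfolding computable2_def using eval_Proj'(2,3) by blast+

lemma computable2_comp:
  assumes "computable2 H" "computable F" "computable G"
  shows "computable (\<lambda>x. H (F x) (G x))"
proof -
  obtain h f g where "\<And>x y. eval h [x, y] (H x y)" "\<And>x. eval f [x] (F x)" "\<And>x. eval g [x] (G x)"
    using assms by (auto simp: computable_def computable2_def)
  then have "eval (Comp 1 h [f, g]) [x] (H (F x) (G x))" for x
    by (intro eval_Comp2[of _ _ _ "F x" _ "G x"]) auto
  then show ?thesis unfolding computable_def by blast
qed

lemma computable2_comp2:
  assumes "computable2 H" "computable2 F" "computable2 G"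
  shows "computable2 (\<lambda>x y. H (F x y) (G x y))"
proof -
  obtain h f g where "\<And>x y. eval h [x, y] (H x y)" "\<And>x y. eval f [x, y] (F x y)" "\<And>x y. eval g [x,
      y] (G x y)"
    using assms by (auto simp: computable2_def)
  then have "eval (Comp 2 h [f, g]) [x, y] (H (F x y) (G x y))" for x y
    by (intro eval_Comp2[of _ _ _ "F x y" _ "G x y"]) auto
  then show ?thesis unfolding computable2_def by blast
qed

lemma computable2_comp1: "computable H \<Longrightarrow> computable2 F \<Longrightarrow> computable2 (\<lambda>x y. H (F x y))"
  unfolding computable_def computable2_def by (elim exE, intro exI allI, rule eval_Comp1) auto

lemma computable2_iter:
  assumes "computable F"
  shows "computable2 (\<lambda>n x. (F ^^ n) x)"
proof -
  obtain f where f: "\<And>x. eval f [x] (F x)" using assms by (auto simp: computable_def)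
  have "eval (PrRec 1 (Proj 1 0) (Comp 3 f [Proj 3 1])) [n, x] ((F ^^ n) x)" for n x
  proof (induction n)
    case 0
    show ?case using eval_Pr0[OF _ eval_Proj'(1), where n = 1] by simp
  next
    case (Suc n)
    show ?case
      using eval_PrS[OF Suc] eval_Comp1[OF _ eval_Proj'(4) f, where n = 3] by simp
  qed
  then show ?thesis unfolding computable2_def by blast
qed

lemma computable_iter: "computable F \<Longrightarrow> computable N \<Longrightarrow> computable G \<Longrightarrow> computable (\<lambda>x. (F ^^ N x) (G
    x))"
  by (rule computable2_comp[OF computable2_iter])

lemma computable_rec:
  assumes "computable2 G" and "F 0 = 0" and "\<And>x. F (Suc x) = G x (F x)"
  shows "computable F"
proof -
  obtain g where g: "\<And>x y. eval g [x, y] (G x y)" using assms(1) by (auto simp: computable2_def)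
  have "eval (PrRec 0 Zero g) [x] (F x)" for x
  proof (induction x)
    case 0
    show ?case using eval_Pr0[OF _ eval_Zero, where n = 0 and xs = "[]"] by (simp add: assms)
  next
    case (Suc x)
    show ?case using eval_PrS[OF Suc g] by (simp add: assms)
  qed
  then show ?thesis unfolding computable_def by blast
qed

lemma computable2_add: "computable2 (+)"
proof -
  have "(Suc ^^ n) x = n + x" for n x by simp
  then show ?thesis using computable2_iter[OF computable_Suc] by simp
qed

lemma computable_pred: "computable (\<lambda>x. x - 1)"
  by (rule computable_rec[OF computable2_fst]) auto

lemma computable2_diff: "computable2 (\<lambda>x y. x - y)"
proof -
  have "((\<lambda>x. x - 1) ^^ n) x = x - n" for n x :: nat by (induction n) auto
  then have "computable2 (\<lambda>n x. x - n)" using computable2_iter[OF computable_pred] by simp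
  then show ?thesis using computable2_comp2[OF _ computable2_snd computable2_fst] by simp
qed

lemma computable_mu:
  assumes "computable2 H" and "\<And>x. H (F x) x = 0" and "\<And>x i. i < F x \<Longrightarrow> H i x \<noteq> 0"
  shows "computable F"
proof -
  obtain h where h: "\<And>x y. eval h [x, y] (H x y)" using assms(1) by (auto simp: computable2_def)
  have "eval (Mu 1 h) [x] (F x)" for x
  proof (rule eval_Mu)
    show "eval h [F x, x] 0" using h[of "F x" x] assms(2) by simp
    show "\<forall>i<F x. \<exists>k. eval h [i, x] (Suc k)"
      using h assms(3) by (metis not0_implies_Suc)
  qed simp
  then show ?thesis unfolding computable_def by blast
qed

text \<open>A case distinction is a primitive recursion on the value of \<open>C\<close>: the base
  gives \<open>F\<close>, and every step discards the previous value and gives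
  \<open>G\<close>.\<close>

lemma computable_if:
  assumes "computable C" "computable F" "computable G"
  shows "computable (\<lambda>x. if C x = 0 then F x else G x)"
proof -
  obtain c f g where c: "\<And>x. eval c [x] (C x)" and f: "\<And>x. eval f [x] (F x)"
    and g: "\<And>x. eval g [x] (G x)"
    using assms by (auto simp: computable_def)
  let ?r = "PrRec 1 f (Comp 3 g [Proj 3 2])"
  have r: "eval ?r [k, x] (if k = 0 then F x else G x)" for k x
  proof (induction k)
    case 0
    show ?case using eval_Pr0[OF _ f, where n = 1] by simp
  next
    case (Suc k)
    show ?case
      using eval_PrS[OF Suc] eval_Comp1[OF _ eval_Proj'(5) g, where n = 3] by simp
  qed
  have "eval (Comp 1 ?r [c, Proj 1 0]) [x] (if C x = 0 then F x else G x)" for x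
    by (rule eval_Comp2[OF _ c eval_Proj'(1) r]) simp
  then show ?thesis unfolding computable_def by blast
qed

section \<open>Cantor pairing and its inverse\<close>

lemma computable_triangle: "computable triangle"
  by (rule computable_rec[OF computable2_comp1[OF computable_Suc computable2_add]]) auto

lemma computable2_prod_encode: "computable2 (\<lambda>m n. prod_encode (m, n))"
  unfolding prod_encode_def prod.case
  by (intro computable2_comp2[OF computable2_add] computable2_comp1[OF computable_triangle]
      computable2_fst computable2_add)

lemma triangle_mono: "m \<le> n \<Longrightarrow> triangle m \<le> triangle n"
  by (induction n) (auto simp: le_Suc_eq)

lemma prod_decode_sum:
  "z = triangle (fst (prod_decode z) + snd (prod_decode z)) + fst (prod_decode z)"
proof -
  have "z = prod_encode (fst (prod_decode z), snd (prod_decode z))" by simp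
  then show ?thesis unfolding prod_encode_def prod.case .
qed

text \<open>The sum of the coordinates is the diagonal of \<open>z\<close>, the least
  \<open>s\<close> with \<open>z < triangle (Suc s)\<close>; both coordinates then follow by
  subtraction.\<close>

lemma computable_root: "computable (\<lambda>z. fst (prod_decode z) + snd (prod_decode z))"
proof (rule computable_mu)
  show "computable2 (\<lambda>s z. Suc z - triangle (Suc s))"
    by (intro computable2_comp2[OF computable2_diff] computable2_comp1[OF computable_Suc]
        computable2_comp1[OF computable_triangle] computable2_fst computable2_snd)
  fix z
  define m n where mn: "m = fst (prod_decode z)" "n = snd (prod_decode z)"
  have z: "z = triangle (m + n) + m"
    unfolding mn by (rule prod_decode_sum)
  show "Suc z - triangle (Suc (fst (prod_decode z) + snd (prod_decode z))) = 0"
    using z unfolding mn[symmetric] by simp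
  fix i
  assume "i < fst (prod_decode z) + snd (prod_decode z)"
  then have "triangle (Suc i) \<le> triangle (m + n)"
    by (intro triangle_mono) (simp add: mn)
  then show "Suc z - triangle (Suc i) \<noteq> 0" using z by linarith
qed

lemma computable_fst_decode: "computable (\<lambda>z. fst (prod_decode z))"
proof -
  have "fst (prod_decode z) = z - triangle (fst (prod_decode z) + snd (prod_decode z))" for z
    using prod_decode_sum[of z] by linarith
  moreover have "computable (\<lambda>z. z - triangle (fst (prod_decode z) + snd (prod_decode z)))"
    by (intro computable2_comp[OF computable2_diff] computable_id computable_comp[OF
        computable_triangle] computable_root)
  ultimately show ?thesis by simp
qed

lemma computable_snd_decode: "computable (\<lambda>z. snd (prod_decode z))"
  using computable2_comp[OF computable2_diff computable_root computable_fst_decode] by simp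

section \<open>Operations on codes of lists\<close>

definition lcons :: "nat \<Rightarrow> nat \<Rightarrow> nat" where
  "lcons x xs = Suc (prod_encode (x, xs))"

definition lhd :: "nat \<Rightarrow> nat" where
  "lhd l = fst (prod_decode (l - 1))"

definition ltl :: "nat \<Rightarrow> nat" where
  "ltl l = snd (prod_decode (l - 1))"

lemma lcons_list_encode [simp]: "lcons x (list_encode xs) = list_encode (x # xs)"
  by (simp add: lcons_def)

lemma lhd_list_encode [simp]: "lhd (list_encode (x # xs)) = x"
  by (simp add: lhd_def)

lemma ltl_list_encode [simp]: "ltl (list_encode (x # xs)) = list_encode xs"
  by (simp add: ltl_def)

lemma computable_lcons: "computable F \<Longrightarrow> computable G \<Longrightarrow> computable (\<lambda>x. lcons (F x) (G x))"
  unfolding lcons_def by (intro computable_comp[OF computable_Suc] computable2_comp[OF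
      computable2_prod_encode])

lemma computable_lhd: "computable lhd"
  unfolding lhd_def[abs_def] by (rule computable_comp[OF computable_fst_decode computable_pred])

lemma computable_ltl: "computable ltl"
  unfolding ltl_def[abs_def] by (rule computable_comp[OF computable_snd_decode computable_pred])

lemma computable_prepend: "computable F \<Longrightarrow> computable (\<lambda>x. foldr lcons c (F x))"
  by (induction c) (auto intro: computable_lcons computable_const)

lemma foldr_lcons [simp]: "foldr lcons c (list_encode xs) = list_encode (c @ xs)"
  by (induction c) (auto simp del: list_encode.simps)

lemma length_le_list_encode: "length xs \<le> list_encode xs"
  by (induction xs) (auto intro: le_trans[OF _ le_prod_encode_2])

text \<open>The state is a pair of encoded lists: the letters still to be read and the output so far.
  Code numbers bound lengths, so iterating as often as the code number of the input suffices.\<close>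
definition push_step :: "nat list \<Rightarrow> nat list \<Rightarrow> nat \<Rightarrow> nat" where
  "push_step c0 c1 z = (let l = fst (prod_decode z); a = snd (prod_decode z) in
     if l = 0 then z
     else prod_encode (ltl l, if lhd l = 0 then foldr lcons c0 a else foldr lcons c1 a))"

definition push :: "nat list \<Rightarrow> nat list \<Rightarrow> nat \<Rightarrow> nat \<Rightarrow> nat" where
  "push c0 c1 l a = snd (prod_decode ((push_step c0 c1 ^^ l) (prod_encode (l, a))))"

lemma computable_push:
  assumes "computable F" "computable G"
  shows "computable (\<lambda>x. push c0 c1 (F x) (G x))"
proof -
  have "computable (push_step c0 c1)"
    unfolding push_step_def[abs_def] Let_def
    by (intro computable_if computable2_comp[OF computable2_prod_encode] computable_comp[OF
        computable_ltl] computable_comp[OF computable_lhd]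
        computable_prepend computable_fst_decode computable_snd_decode computable_id)
  then show ?thesis unfolding push_def
    by (intro computable_comp[OF computable_snd_decode] computable_iter computable2_comp[OF
        computable2_prod_encode] assms)
qed

lemma push_step_iter:
  "length w \<le> n \<Longrightarrow> (push_step c0 c1 ^^ n) (prod_encode (list_encode w, list_encode a)) =
     prod_encode (0, list_encode (concat (map (\<lambda>x. if x = 0 then c0 else c1) (rev w)) @ a))"
proof (induction w arbitrary: n a)
  case Nil
  have "push_step c0 c1 (prod_encode (0, k)) = prod_encode (0, k)" for k
    by (simp add: push_step_def)
  then have "(push_step c0 c1 ^^ n) (prod_encode (0, k)) = prod_encode (0, k)" for k
    by (induction n) auto
  then show ?case by simp
next
  case (Cons x w)
  then obtain m where n: "n = Suc m" "length w \<le> m" by (cases n) auto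
  have "push_step c0 c1 (prod_encode (list_encode (x # w), list_encode a)) =
      prod_encode (list_encode w, list_encode ((if x = 0 then c0 else c1) @ a))"
    using lhd_list_encode[of x w] ltl_list_encode[of x w] by (simp add: push_step_def)
  then show ?case using Cons.IH[OF n(2)]
    by (simp add: n funpow_swap1 del: list_encode.simps funpow.simps(2) add: funpow_Suc_right)
qed

text \<open>The first letter read ends up deepest in the output, whence \<open>rev\<close>. Inverse
  words need this reversal anyway; for positive words a preliminary pass undoes it.\<close>

lemma push_list_encode:
  "push c0 c1 (list_encode w) (list_encode a) =
     list_encode (concat (map (\<lambda>x. if x = 0 then c0 else c1) (rev w)) @ a)"
  by (simp add: push_def push_step_iter length_le_list_encode)

section \<open>Affine actions of free groups\<close>

fun act :: "('a \<Rightarrow> real) \<Rightarrow> ('a \<Rightarrow> real) \<Rightarrow> 'a word \<Rightarrow> real \<Rightarrow> real" where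
  "act l t [] y = y"
| "act l t ((b, x) # w) y = (if b then (act l t w y - t x) / l x else t x + l x * act l t w y)"

lemma act_append: "act l t (u @ v) y = act l t u (act l t v y)"
  by (induction l t u y rule: act.induct) auto

lemma act_mk:
  assumes "\<And>x. l x \<noteq> 0" and "mk w = 0"
  shows "act l t w y = y"
proof -
  have "act l t (nf w) = act l t w"
    by (rule nf_invariant) (use assms(1) in \<open>auto simp: fun_eq_iff\<close>)
  then have "act l t w y = act l t (nf w) y" by simp
  then show ?thesis using assms(2) by (simp add: mk_eq_0_iff)
qed

section \<open>The generators\<close>

text \<open>The letters 0, 1, 2, 3 of the second component are states p, q, r, s: in blocks of check type
  one starts in p, loops with TA, moves to q by TC and loops with TB. The loops TR at r and TS at s
  are inverse to TA and TB; they are reachable only in the blocks of type 4 (r to p by TT) and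
  5 (q to s by TU). The last index has a loop TB but no TA, its first word being carried by TC.\<close>
datatype tok = TA nat | TB nat | TR nat | TS nat | TC | TT | TU | TD nat

text \<open>1 and 0 are the only integers \<open>m\<close> for which \<open>yw m\<close> has no
  inverse letter, so the images of positive words and of their inverses under \<open>phi\<close> are
  one-signed.\<close>

definition gen_index :: "gen \<Rightarrow> int" where
  "gen_index g = (case g of GA \<Rightarrow> 1 | GB \<Rightarrow> 0)"

definition pos_word :: "gen list \<Rightarrow> int word" where
  "pos_word u = map (\<lambda>g. (False, gen_index g)) u"

text \<open>The offset keeps index letters apart from the four states; \<open>scl\<close> and
  \<open>shf\<close> tell them apart by the threshold 4.\<close>

definition idx :: "nat \<Rightarrow> int" where
  "idx i = int i + 4"

definition entry1 :: "(gen list \<times> gen list) list \<Rightarrow> nat \<Rightarrow> int word" where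
  "entry1 P k = (if k < 4 then pos_word (fst (P ! 0)) else [])"

definition exit1 :: "(gen list \<times> gen list) list \<Rightarrow> nat \<Rightarrow> int word" where
  "exit1 P k = (if k < 4 then winv (pos_word (snd (P ! 0))) else [])"

definition entry2 :: "nat \<Rightarrow> int word" where
  "entry2 k = [(True, if k < 4 then 0 else if k = 4 then 2 else 1)]"

definition exit2 :: "nat \<Rightarrow> int word" where
  "exit2 k = [(False, if k < 4 then 1 else if k = 4 then 0 else 3)]"

fun L1 :: "(gen list \<times> gen list) list \<Rightarrow> tok \<Rightarrow> int word" where
  "L1 P (TA i) = pos_word (fst (P ! i))"
| "L1 P (TB i) = winv (pos_word (snd (P ! i)))"
| "L1 P (TR i) = winv (pos_word (fst (P ! i)))"
| "L1 P (TS i) = pos_word (snd (P ! i))"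
| "L1 P TC = pos_word (fst (P ! (length P - 1)))"
| "L1 P TT = []"
| "L1 P TU = []"
| "L1 P (TD k) = exit1 P k @ [(True, barrier k), (False, barrier (next_type k))] @ entry1 P
    (next_type k)"

text \<open>A transition from state x to state y begins with the letter x and ends with the inverse
  of y, so the states along a path telescope and the index letters remain.\<close>

fun L2 :: "nat \<Rightarrow> tok \<Rightarrow> int word" where
  "L2 n (TA i) = [(False, 0), (False, idx i), (True, 0)]"
| "L2 n (TB i) = [(False, 1), (True, idx i), (True, 1)]"
| "L2 n (TR i) = [(False, 2), (True, idx i), (True, 2)]"
| "L2 n (TS i) = [(False, 3), (False, idx i), (True, 3)]"
| "L2 n TC = [(False, 0), (False, idx (n - 1)), (True, 1)]"
| "L2 n TT = [(False, 2), (True, 0)]"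
| "L2 n TU = [(False, 1), (True, 3)]"
| "L2 n (TD k) = exit2 k @ [(True, barrier k), (False, barrier (next_type k))] @ entry2 (next_type
    k)"

definition W1 :: "(gen list \<times> gen list) list \<Rightarrow> tok list \<Rightarrow> int word" where
  "W1 P ts = concat (map (L1 P) ts)"

definition W2 :: "nat \<Rightarrow> tok list \<Rightarrow> int word" where
  "W2 n ts = concat (map (L2 n) ts)"

text \<open>The copies of TD 0 only pad the list to length 8 (n - 1).\<close>
definition toks :: "nat \<Rightarrow> tok list" where
  "toks n = concat (map (\<lambda>i. [TA i, TB i, TR i, TS i]) [1..<n - 1]) @ [TB (n - 1), TC, TT, TU] @
     map TD [0..<6] @ replicate (8 * (n - 1) - (4 * (n - 2) + 10)) (TD 0)"

lemma length_toks:
  assumes "3 \<le> n"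
  shows "length (toks n) = 8 * (n - 1)"
proof -
  have "length (concat (map (\<lambda>i. [TA i, TB i, TR i, TS i]) xs)) = 4 * length xs" for xs
    by (induction xs) auto
  then show ?thesis using assms by (simp add: toks_def)
qed

lemma set_toks:
  "set (toks n) = (\<Union>i\<in>{1..<n - 1}. {TA i, TB i, TR i, TS i}) \<union> {TB (n - 1), TC, TT, TU} \<union> TD `
      {..<6}"
  by (auto simp: toks_def atLeast0LessThan)

lemma W_simps [simp]:
  "W1 P [] = []" "W1 P (t # ts) = L1 P t @ W1 P ts" "W1 P (ts @ ts') = W1 P ts @ W1 P ts'"
  "W2 n [] = []" "W2 n (t # ts) = L2 n t @ W2 n ts" "W2 n (ts @ ts') = W2 n ts @ W2 n ts'"
  by (simp_all add: W1_def W2_def)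

lemma pos_word_simps [simp]: "pos_word [] = []" "pos_word (u @ v) = pos_word u @ pos_word v"
  by (simp_all add: pos_word_def)

lemma inj_gen_index: "inj gen_index"
  by (auto simp: inj_def gen_index_def split: gen.splits)

lemma inj_idx: "inj idx"
  by (auto simp: inj_def idx_def)

lemma barrier_free_pos_word: "barrier_free (pos_word u)" "barrier_free (winv (pos_word u))"
  by (auto simp: barrier_free_def pos_word_def winv_def gen_index_def split: gen.splits)

lemma barrier_free_W1: "\<forall>k. TD k \<notin> set ts \<Longrightarrow> barrier_free (W1 P ts)"
proof (induction ts)
  case (Cons t ts)
  then show ?case by (cases t) (auto simp: barrier_free_pos_word)
qed simp

lemma barrier_free_W2: "\<forall>k. TD k \<notin> set ts \<Longrightarrow> barrier_free (W2 n ts)"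
proof (induction ts)
  case (Cons t ts)
  then show ?case by (cases t) (auto simp: idx_def)
qed simp

lemma barrier_free_en_ex: "barrier_free (entry1 P k)" "barrier_free (exit1 P k)" "barrier_free
    (entry2 k)" "barrier_free (exit2 k)"
  by (auto simp: entry1_def exit1_def entry2_def exit2_def barrier_free_pos_word)

section \<open>From the identity to a solution\<close>

text \<open>Both components are cut at the same barriers, so their segments come from the same token
  lists \<open>z\<close> and can be compared one by one.\<close>

lemma decompose:
  "\<exists>z0 its. W1 P ts = item_word (exit1 P) (W1 P z0) (map (\<lambda>(i, z). (i, entry1 P (next_type i) @ W1
      P z)) its) \<and>
     W2 n ts = item_word exit2 (W2 n z0) (map (\<lambda>(i, z). (i, entry2 (next_type i) @ W2 n z)) its) \<and>
     (\<forall>(i, z)\<in>set its. TD i \<in> set ts \<and> set z \<subseteq> set ts \<and> (\<forall>k. TD k \<notin> set z)) \<and>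
     (\<forall>k. TD k \<notin> set z0) \<and> (its = [] \<longrightarrow> (\<forall>k. TD k \<notin> set ts))"
proof (induction ts rule: rev_induct)
  case Nil
  show ?case by (rule exI[of _ "[]"], rule exI[of _ "[]"]) auto
next
  case (snoc t ts)
  then obtain z0 its where
    w: "W1 P ts = item_word (exit1 P) (W1 P z0) (map (\<lambda>(i, z). (i, entry1 P (next_type i) @ W1 P
        z)) its)"
     "W2 n ts = item_word exit2 (W2 n z0) (map (\<lambda>(i, z). (i, entry2 (next_type i) @ W2 n z)) its)"
         and
    its: "\<forall>(i, z)\<in>set its. TD i \<in> set ts \<and> set z \<subseteq> set ts \<and> (\<forall>k. TD k \<notin> set z)" and
    z0: "\<forall>k. TD k \<notin> set z0" "its = [] \<longrightarrow> (\<forall>k. TD k \<notin> set ts)"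
    by blast
  show ?case
  proof (cases "\<exists>k. t = TD k")
    case True
    then obtain k where "t = TD k" by blast
    then show ?thesis using w its z0
      by (intro exI[of _ z0] exI[of _ "(k, []) # its"]) auto
  next
    case False
    show ?thesis
    proof (cases its)
      case Nil
      then show ?thesis using w z0 False
        by (intro exI[of _ "z0 @ [t]"] exI[of _ "[]"]) auto
    next
      case (Cons a its')
      obtain i z where "a = (i, z)" by (cases a)
      then show ?thesis using w its z0 False Cons
        by (intro exI[of _ z0] exI[of _ "(i, z @ [t]) # its'"]) auto
    qed
  qed
qed

lemma commonD:
  "common e1 e2 its j \<Longrightarrow>
     \<exists>(i, M, N)\<in>set its. next_type i < 4 \<and> mk (M @ e1 (next_type i)) = 0 \<and> mk (N @ e2 (next_type
         i)) = 0"
  by (induction e1 e2 its j rule: common.induct) auto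

lemma ex_check_segment:
  assumes "mk (W1 P ts) = 0" "mk (W2 n ts) = 0" and "TD k \<in> set ts"
    and six: "\<forall>i. TD i \<in> set ts \<longrightarrow> i < 6"
  shows "\<exists>z. set z \<subseteq> set ts \<and> (\<forall>k. TD k \<notin> set z) \<and>
    mk (pos_word (fst (P ! 0)) @ W1 P z @ winv (pos_word (snd (P ! 0)))) = 0 \<and>
    mk ([(True, 0)] @ W2 n z @ [(False, 1)]) = 0"
proof -
  obtain z0 its where
    w: "W1 P ts = item_word (exit1 P) (W1 P z0) (map (\<lambda>(i, z). (i, entry1 P (next_type i) @ W1 P
        z)) its)"
     "W2 n ts = item_word exit2 (W2 n z0) (map (\<lambda>(i, z). (i, entry2 (next_type i) @ W2 n z)) its)"
         and
    its: "\<forall>(i, z)\<in>set its. TD i \<in> set ts \<and> set z \<subseteq> set ts \<and> (\<forall>k. TD k \<notin> set z)" and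
    z0: "\<forall>k. TD k \<notin> set z0" "its \<noteq> []"
    using decompose[of P ts n] assms(3) by blast
  let ?its = "map (\<lambda>(i, z). (i, entry1 P (next_type i) @ W1 P z, entry2 (next_type i) @ W2 n z))
      its"
  have m: "map (\<lambda>(i, M, N). (i, M)) ?its = map (\<lambda>(i, z). (i, entry1 P (next_type i) @ W1 P z)) its"
    "map (\<lambda>(i, M, N). (i, N)) ?its = map (\<lambda>(i, z). (i, entry2 (next_type i) @ W2 n z)) its"
    by auto
  \<comment> \<open>The last segment is followed by no barrier; \<open>ex_common\<close> holds for
    any fictitious next index, here 0.\<close>
  have "common (exit1 P) exit2 ?its 0"
    by (rule ex_common[of _ "W1 P z0" "W2 n z0"])
      (use its z0 six w assms(1,2) in \<open>auto simp: m barrier_free_en_ex simp del: map_map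
        intro!: barrier_free_W1 barrier_free_W2\<close>)
  from commonD[OF this] obtain i z where iz: "(i, z) \<in> set its" "next_type i < 4"
    "mk ((entry1 P (next_type i) @ W1 P z) @ exit1 P (next_type i)) = 0" "mk ((entry2 (next_type
        i) @ W2 n z) @ exit2 (next_type i)) = 0"
    by auto
  then show ?thesis using its
    by (intro exI[of _ z]) (auto simp: entry1_def exit1_def entry2_def exit2_def)
qed

text \<open>With all scalings 1 and a translation at a single letter, the action measures the
  exponent sum of that letter; loops contribute nothing.\<close>

lemma act_exponent:
  assumes "\<forall>k. TD k \<notin> set z"
  shows "act (\<lambda>_. 1) (\<lambda>x. if x = 2 then 1 else 0) (W2 n z) y = y + count_list z TT"
    and "act (\<lambda>_. 1) (\<lambda>x. if x = 3 then 1 else 0) (W2 n z) y = y - count_list z TU"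
    and "act (\<lambda>_. 1) (\<lambda>x. if x = 0 then 1 else 0) (W2 n z) y =
      y + real (count_list z TC) - count_list z TT"
  using assms
proof (induction z)
  case (Cons t z)
  case 1 then show ?case using Cons by (cases t) (auto simp: idx_def)
  case 2 then show ?case using Cons by (cases t) (auto simp: idx_def)
  case 3 then show ?case using Cons by (cases t) (auto simp: idx_def)
qed auto

definition loop_count :: "(nat \<Rightarrow> tok) \<Rightarrow> tok list \<Rightarrow> nat" where
  "loop_count T z = length (filter (\<lambda>t. t \<in> range T) z)"

lemma loop_count_simps [simp]:
  "loop_count T [] = 0" "loop_count T (t # z) = (if t \<in> range T then Suc (loop_count T z) else
      loop_count T z)"
  by (simp_all add: loop_count_def)

lemma loop_count_eq_0_iff: "loop_count T z = 0 \<longleftrightarrow> (\<forall>i. T i \<notin> set z)"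
  by (induction z) auto

definition loops :: "tok list \<Rightarrow> bool" where
  "loops z \<longleftrightarrow> TC \<notin> set z \<and> TT \<notin> set z \<and> TU \<notin> set z \<and> (\<forall>k. TD k \<notin> set z)"

abbreviation scl :: "(int \<Rightarrow> real) \<Rightarrow> int \<Rightarrow> real" where
  "scl l x \<equiv> (if x < 4 then l x else 1)"

abbreviation shf :: "int \<Rightarrow> real" where
  "shf x \<equiv> (if x < 4 then 0 else 1)"

text \<open>A loop is a unit translation conjugated by the scaling of its state, hence a translation
  by that scaling factor.\<close>

lemma act_loops:
  assumes "loops z" and "\<And>x. l x \<noteq> 0"
  shows "act (scl l) shf (W2 n z) y =
    y + l 0 * loop_count TA z - l 1 * loop_count TB z - l 2 * loop_count TR z + l 3 * loop_count
        TS z"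
  using assms(1)
proof (induction z)
  case (Cons t z)
  then have "loops z" by (simp add: loops_def)
  then show ?case using Cons assms(2)
    by (cases t) (auto simp: idx_def loops_def algebra_simps)
qed auto

lemma mk_W2_TA:
  "mk (W2 n (map TA xs)) = mk [(False, 0)] + mk (map (\<lambda>i. (False, idx i)) xs) - mk [(False, 0)]"
  by (induction xs) (simp_all add: mk_append mk_Cons[of _ "_ # _"] mk_Cons[of _ "map _ _"]
      mk_Cons[of _ "W2 _ _"] mk_True
      add.assoc diff_conv_add_uminus del: add_uminus_conv_diff)

lemma mk_W2_TB:
  "mk (W2 n (map TB ys)) = mk [(False, 1)] - mk (map (\<lambda>i. (False, idx i)) (rev ys)) - mk [(False,
      1)]"
  by (induction ys) (simp_all add: mk_append mk_Cons[of _ "_ # _"] mk_Cons[of _ "W2 _ _"] mk_True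
      add.assoc diff_conv_add_uminus minus_add del: add_uminus_conv_diff)

lemma mk_W1_TA: "mk (W1 P (map TA xs)) = mk (pos_word (concat (map (\<lambda>i. fst (P ! i)) xs)))"
  by (induction xs) (simp_all add: mk_append)

lemma mk_W1_TB: "mk (W1 P (map TB ys)) = - mk (pos_word (concat (map (\<lambda>i. snd (P ! i)) (rev ys))))"
  by (induction ys) (simp_all add: mk_append mk_winv minus_add diff_conv_add_uminus del:
      add_uminus_conv_diff)

lemma all_in_range: "\<forall>t\<in>set z. t \<in> range T \<Longrightarrow> \<exists>xs. z = map T xs"
  by (induction z) (auto intro: exI[of _ "_ # _"])

text \<open>Letting the state letters act on the line by scalings and the index letters by the unit
  translation, the total translation is a Laurent polynomial in the scaling factors whose vanishing
  determines the shape of the segment; a few values of the factors suffice.\<close>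
lemma check_segment:
  assumes n: "length P = n" "3 \<le> n" and z: "set z \<subseteq> set (toks n)" "\<forall>k. TD k \<notin> set z"
    and 1: "mk (pos_word (fst (P ! 0)) @ W1 P z @ winv (pos_word (snd (P ! 0)))) = 0"
    and 2: "mk ([(True, 0)] @ W2 n z @ [(False, 1)]) = 0"
  shows "rpcp_solvable P"
proof -
  note ac = act_mk[OF _ 2, unfolded act_append]
  \<comment> \<open>Exponent sums of r, s and p: the border letters contain neither r nor s, and
    contribute -1 for p, so \<open>TC\<close> occurs exactly once.\<close>
  have TT: "count_list z TT = 0"
    using ac[of "\<lambda>_. 1" "\<lambda>x. if x = 2 then 1 else 0" 0] by (simp add: act_exponent[OF z(2)])
  have TU: "count_list z TU = 0"
    using ac[of "\<lambda>_. 1" "\<lambda>x. if x = 3 then 1 else 0" 0] by (simp add: act_exponent[OF z(2)])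
  have TC: "count_list z TC = 1"
    using ac[of "\<lambda>_. 1" "\<lambda>x. if x = 0 then 1 else 0" 0] by (simp add: act_exponent[OF z(2)] TT)
  then have "TC \<in> set z" by (metis count_list_0_iff zero_neq_one)
  then obtain X Y where XY: "z = X @ TC # Y" "TC \<notin> set X" by (metis split_list_first)
  then have "count_list Y TC = 0" using TC by (simp add: count_list_append)
  then have loops: "loops X" "loops Y"
    using XY TT TU z(2) by (auto simp: loops_def count_list_0_iff)
  \<comment> \<open>\<open>TC\<close> acts as y \<mapsto> l 0 * (1 + y / l 1): the translation of
    \<open>Y\<close> enters with the factor \<open>l 0 / l 1\<close>.\<close>
  have a: "act (scl l) shf (W2 n X) (l 0 * (1 + act (scl l) shf (W2 n Y) (l 1 * 0) / l 1)) / l 0 =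
      0"
    if "\<And>x. l x \<noteq> 0" for l :: "int \<Rightarrow> real"
    using ac[of "scl l" shf 0] that by (simp add: XY act_append idx_def)
  note a = a[unfolded act_loops[OF loops(1)] act_loops[OF loops(2)]]
  have b: "l 0 + l 0 * loop_count TA X - l 1 * loop_count TB X - l 2 * loop_count TR X + l 3 *
      loop_count TS X +
      l 0 / l 1 * (l 0 * loop_count TA Y - l 1 * loop_count TB Y - l 2 * loop_count TR Y + l 3 *
          loop_count TS Y) = 0"
    if "\<And>x. l x \<noteq> 0" for l :: "int \<Rightarrow> real"
    using a[of l] that by (simp add: act_loops[OF loops(1)] act_loops[OF loops(2)] field_simps)
  have nz: "(if x = k then 2 else 1 :: real) \<noteq> 0" for x k :: int by simp
  \<comment> \<open>All factors 1 first; below, one factor at a time is doubled so that the unwanted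
    loops stand out.\<close>
  have c0: "1 + real (loop_count TA X) - loop_count TB X - loop_count TR X + loop_count TS X +
      loop_count TA Y - loop_count TB Y - loop_count TR Y + loop_count TS Y = 0"
    using b[of "\<lambda>_. 1"] by simp
  have c1: "1 + real (loop_count TA X) - loop_count TB X - 2 * real (loop_count TR X) + loop_count
      TS X + loop_count TA Y - loop_count TB Y
      - 2 * real (loop_count TR Y) + loop_count TS Y = 0"
    using b[of "\<lambda>x. if x = 2 then 2 else 1", OF nz] by simp
  have c2: "1 + real (loop_count TA X) - loop_count TB X - loop_count TR X + 2 * real (loop_count
      TS X) + loop_count TA Y - loop_count TB Y
      - loop_count TR Y + 2 * real (loop_count TS Y) = 0"
    using b[of "\<lambda>x. if x = 3 then 2 else 1", OF nz] by simp
  have c3: "2 + 2 * real (loop_count TA X) - loop_count TB X - loop_count TR X + loop_count TS X +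
      4 * real (loop_count TA Y) - 2 * real (loop_count TB Y)
      - 2 * real (loop_count TR Y) + 2 * real (loop_count TS Y) = 0"
    using b[of "\<lambda>x. if x = 0 then 2 else 1", OF nz] by simp
  have R: "loop_count TR X = 0" "loop_count TR Y = 0" using c0 c1 by linarith+
  have S: "loop_count TS X = 0" "loop_count TS Y = 0" using c0 c2 by linarith+
  \<comment> \<open>Subtracting twice \<open>c0\<close> from \<open>c3\<close> leaves
    \<open>loop_count TB X + 2 * loop_count TA Y = 0\<close>.\<close>
  have AB: "loop_count TB X = 0" "loop_count TA Y = 0" using c0 c3 R S by linarith+
  have X: "\<forall>t\<in>set X. t \<in> range TA"
  proof
    fix t assume "t \<in> set X"
    then show "t \<in> range TA"
      using loops(1) R(1)[unfolded loop_count_eq_0_iff] S(1)[unfolded loop_count_eq_0_iff]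
          AB(1)[unfolded loop_count_eq_0_iff]
      by (cases t rule: tok.exhaust) (auto simp: loops_def)
  qed
  have Y: "\<forall>t\<in>set Y. t \<in> range TB"
  proof
    fix t assume "t \<in> set Y"
    then show "t \<in> range TB"
      using loops(2) R(2)[unfolded loop_count_eq_0_iff] S(2)[unfolded loop_count_eq_0_iff]
          AB(2)[unfolded loop_count_eq_0_iff]
      by (cases t rule: tok.exhaust) (auto simp: loops_def)
  qed
  obtain xs ys where xs: "X = map TA xs" and ys: "Y = map TB ys"
    using all_in_range[OF X] all_in_range[OF Y] by blast
  \<comment> \<open>The states telescope, and the index letters of the A's must match those of the
    B's read backwards. \<open>TC\<close> supplies the final index.\<close>
  have "mk (map (\<lambda>i. (False, idx i)) (xs @ [n - 1])) = mk (map (\<lambda>i. (False, idx i)) (rev ys))"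
    using 2 by (simp add: XY xs ys mk_append mk_Cons[of _ "_ # _"] mk_Cons[of _ "_ @ _"] mk_W2_TA
        mk_W2_TB mk_True
        add.assoc diff_conv_add_uminus del: add_uminus_conv_diff)
     (simp add: add_diff_eq)
  then have "xs @ [n - 1] = rev ys"
    by (rule mk_pos_word_inject[OF inj_idx])
  let ?U = "fst (P ! 0) @ concat (map (\<lambda>l. fst (P ! l)) xs) @ fst (P ! (n - 1))"
  let ?V = "snd (P ! 0) @ concat (map (\<lambda>l. snd (P ! l)) (xs @ [n - 1]))"
  have "mk (pos_word ?U) + - mk (pos_word ?V) = 0"
    using 1 unfolding \<open>xs @ [n - 1] = rev ys\<close>
    by (simp add: XY xs ys n mk_append mk_W1_TA mk_W1_TB mk_winv
        add.assoc diff_conv_add_uminus minus_add del: add_uminus_conv_diff)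
  then have "mk (pos_word ?U) = mk (pos_word ?V)" by simp
  then have "?U = ?V"
    unfolding pos_word_def by (rule mk_pos_word_inject[OF inj_gen_index])
  moreover have "\<forall>l\<in>set xs. 1 \<le> l \<and> l \<le> n - 2"
  proof
    fix l assume "l \<in> set xs"
    then have "TA l \<in> set (toks n)" using z XY xs by auto
    then show "1 \<le> l \<and> l \<le> n - 2" by (auto simp: set_toks)
  qed
  ultimately show ?thesis
    unfolding rpcp_solvable_def Let_def n by (intro exI[of _ xs]) simp
qed

section \<open>From a solution to the identity\<close>

lemma mk_W2_TR:
  "mk (W2 n (map TR xs)) = mk [(False, 2)] - mk (map (\<lambda>i. (False, idx i)) (rev xs)) - mk [(False,
      2)]"
  by (induction xs) (simp_all add: mk_append mk_Cons[of _ "_ # _"] mk_Cons[of _ "W2 _ _"] mk_True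
      add.assoc diff_conv_add_uminus minus_add del: add_uminus_conv_diff)

lemma mk_W2_TS:
  "mk (W2 n (map TS xs)) = mk [(False, 3)] + mk (map (\<lambda>i. (False, idx i)) xs) - mk [(False, 3)]"
  by (induction xs) (simp_all add: mk_append mk_Cons[of _ "_ # _"] mk_Cons[of _ "map _ _"]
      mk_Cons[of _ "W2 _ _"] mk_True add.assoc diff_conv_add_uminus del: add_uminus_conv_diff)

lemma mk_W1_TR: "mk (W1 P (map TR xs)) = - mk (pos_word (concat (map (\<lambda>i. fst (P ! i)) (rev xs))))"
  by (induction xs) (simp_all add: mk_append mk_winv minus_add diff_conv_add_uminus del:
      add_uminus_conv_diff)

lemma mk_W1_TS: "mk (W1 P (map TS xs)) = mk (pos_word (concat (map (\<lambda>i. snd (P ! i)) xs)))"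
  by (induction xs) (simp_all add: mk_append)

lemma ex_trivial_product:
  assumes n: "length P = n" "3 \<le> n" and sol: "rpcp_solvable P"
  shows "\<exists>ts. set ts = set (toks n) \<and> mk (W1 P ts) = 0 \<and> mk (W2 n ts) = 0"
proof -
  obtain ls where ls: "\<forall>l\<in>set ls. 1 \<le> l \<and> l \<le> n - 2" and
    eq: "fst (P ! 0) @ concat (map (\<lambda>l. fst (P ! l)) ls) @ fst (P ! (n - 1)) =
       snd (P ! 0) @ concat (map (\<lambda>l. snd (P ! l)) ls) @ snd (P ! (n - 1))"
    using sol unfolding rpcp_solvable_def Let_def n by blast
  define z where "z = map TA ls @ [TC] @ map TB ((n - 1) # rev ls)"
  define I where "I = [1..<n - 1]"
  \<comment> \<open>Independently of the solution, \<open>f\<close> and \<open>g\<close> use every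
    inner index and are trivial up to states, so that all loop tokens occur.\<close>
  define f where "f = map TR (rev I) @ [TT] @ map TA I"
  define g where "g = map TB I @ [TU] @ map TS (rev I)"
  \<comment> \<open>One full cycle: \<open>TD k\<close> is followed by a block of type
    \<open>next_type k\<close>. The block of type 0 comes last; its exit border is the beginning of
    \<open>TD 0\<close>.\<close>
  define ts where "ts = TD 0 # z @ TD 1 # z @ TD 2 # z @ TD 3 # f @ TD 4 # g @ TD 5 # z"
  have six: "{..<6} = {0, 1, 2, 3, 4, 5 :: nat}" by auto
  have "set ts = set (toks n)"
    unfolding set_toks six using ls n(2)
    by (auto simp: ts_def z_def f_def g_def I_def)
  have "mk (pos_word (fst (P ! 0) @ concat (map (\<lambda>l. fst (P ! l)) ls) @ fst (P ! (n - 1)))) =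
      mk (pos_word (snd (P ! 0) @ concat (map (\<lambda>l. snd (P ! l)) ls) @ snd (P ! (n - 1))))"
    by (simp only: eq)
  then have "mk (pos_word (fst (P ! 0))) + mk (W1 P z) = mk (pos_word (snd (P ! 0)))"
    by (simp add: z_def n mk_append mk_W1_TA mk_W1_TB minus_add diff_conv_add_uminus mk_winv
        del: add_uminus_conv_diff flip: add.assoc) simp
  then have "mk (W1 P z) = - mk (pos_word (fst (P ! 0))) + mk (pos_word (snd (P ! 0)))"
    by (metis add.assoc add_0 left_minus)
  moreover have "mk (W1 P f) = 0" "mk (W1 P g) = 0"
    by (simp_all add: f_def g_def mk_append mk_W1_TA mk_W1_TB mk_W1_TR mk_W1_TS)
  moreover have next_type: "next_type 0 = 1" "next_type 1 = 2" "next_type (Suc 0) = 2" "next_type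
      2 = 3" "next_type 3 = 4" "next_type 4 = 5" "next_type 5 = 0"
    by (simp_all add: next_type_def)
  ultimately have "mk (W1 P ts) = 0"
    by (simp add: ts_def mk_append exit1_def entry1_def mk_winv mk_Cons[of _ "_ # _"] mk_True
        mk_Cons[of _ "_ @ _"] mk_Cons[of _ "pos_word _"] add.assoc diff_conv_add_uminus minus_add
        del: add_uminus_conv_diff)
  have "mk (W2 n z) = mk [(False, 0)] - mk [(False, 1)]"
    by (simp add: z_def mk_append mk_W2_TA mk_W2_TB mk_Cons[of _ "_ # _"] mk_Cons[of _ "W2 _ _"]
        mk_True add.assoc diff_conv_add_uminus minus_add del: add_uminus_conv_diff)
  moreover have "mk (W2 n f) = mk [(False, 2)] - mk [(False, 0)]"
    by (simp add: f_def mk_append mk_W2_TA mk_W2_TR mk_Cons[of _ "_ # _"] mk_Cons[of _ "W2 _ _"]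
        mk_True add.assoc diff_conv_add_uminus minus_add del: add_uminus_conv_diff)
  moreover have "mk (W2 n g) = mk [(False, 1)] - mk [(False, 3)]"
    by (simp add: g_def mk_append mk_W2_TB mk_W2_TS mk_Cons[of _ "_ # _"] mk_Cons[of _ "W2 _ _"]
        mk_True add.assoc diff_conv_add_uminus minus_add del: add_uminus_conv_diff)
  ultimately have "mk (W2 n ts) = 0"
    using next_type by (simp add: ts_def mk_append exit2_def entry2_def mk_Cons[of _ "_ # _"]
        mk_True
        mk_Cons[of _ "W2 _ _"]
        mk_Cons[of _ "_ @ _"] add.assoc diff_conv_add_uminus minus_add
        del: add_uminus_conv_diff)
  show ?thesis using \<open>set ts = _\<close> \<open>mk (W1 P ts) = 0\<close> \<open>mk (W2 n ts) = 0\<close> by blast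
qed

section \<open>The semigroup\<close>

definition generator :: "(gen list \<times> gen list) list \<Rightarrow> tok \<Rightarrow> fword \<times> fword" where
  "generator P t = (nf (phi (L1 P t)), nf (phi (L2 (length P) t)))"

definition prod_val :: "(gen list \<times> gen list) list \<Rightarrow> tok list \<Rightarrow> fword \<times> fword" where
  "prod_val P ts = (nf (phi (W1 P ts)), nf (phi (W2 (length P) ts)))"

lemma red_cons_eq_rcons: "red_cons x w = rcons x w"
  by (cases w) (auto simp: inv_letter_def ilet_def)

lemma fg_mult_nf: "fg_mult (nf u) (nf v) = nf (u @ v)"
proof -
  have "red_cons = rcons" by (intro ext) (rule red_cons_eq_rcons)
  then show ?thesis by (simp add: fg_mult_def foldr_rcons_nf nf_append)
qed

lemma prod_val_append: "fg2_mult (prod_val P xs) (prod_val P ys) = prod_val P (xs @ ys)"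
  by (simp add: fg2_mult_def prod_val_def fg_mult_nf phi_append)

lemma prod_val_single: "prod_val P [t] = generator P t"
  by (simp add: prod_val_def generator_def)

lemma prod_val_eq_iff:
  "prod_val P xs = prod_val P ys \<longleftrightarrow> mk (phi (W1 P xs)) = mk (phi (W1 P ys)) \<and>
     mk (phi (W2 (length P) xs)) = mk (phi (W2 (length P) ys))"
  by (simp add: prod_val_def mk_eq_iff)

lemma phi_Nil: "phi [] = []"
  by (simp add: phi_def)

lemma prod_val_Nil_iff: "prod_val P ts = prod_val P [] \<longleftrightarrow> mk (W1 P ts) = 0 \<and> mk (W2 (length P) ts)
    = 0"
  by (simp add: prod_val_eq_iff mk_phi_eq_0_iff phi_Nil)

lemma gen_semigroup_generator: "gen_semigroup (generator P ` T) = {prod_val P ts | ts. ts \<noteq> [] \<and>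
    set ts \<subseteq> T}"
proof (rule equalityI; rule subsetI)
  fix x assume "x \<in> gen_semigroup (generator P ` T)"
  then show "x \<in> {prod_val P ts | ts. ts \<noteq> [] \<and> set ts \<subseteq> T}"
  proof induction
    case (gs_base x)
    then obtain t where "t \<in> T" "x = prod_val P [t]" by (auto simp: prod_val_single)
    then show ?case by (intro CollectI exI[of _ "[t]"]) simp
  next
    case (gs_mult x y)
    then obtain xs ys where "x = prod_val P xs" "y = prod_val P ys" "xs \<noteq> []" "set xs \<subseteq> T" "set ys
        \<subseteq> T"
      by blast
    then show ?case by (intro CollectI exI[of _ "xs @ ys"]) (simp add: prod_val_append)
  qed
next
  fix x assume "x \<in> {prod_val P ts | ts. ts \<noteq> [] \<and> set ts \<subseteq> T}"
  then obtain ts where "ts \<noteq> []" "set ts \<subseteq> T" and x: "x = prod_val P ts" by blast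
  from this(1,2) have "prod_val P ts \<in> gen_semigroup (generator P ` T)"
  proof (induction ts rule: list_nonempty_induct)
    case (single t)
    then show ?case by (simp add: prod_val_single gs_base)
  next
    case (cons t ts)
    then have "prod_val P [t] \<in> gen_semigroup (generator P ` T)" "prod_val P ts \<in> gen_semigroup
        (generator P ` T)"
      by (simp_all add: prod_val_single gs_base)
    from gs_mult[OF this] show ?case by (simp add: prod_val_append)
  qed
  then show "x \<in> gen_semigroup (generator P ` T)" by (simp add: x)
qed

section \<open>Being a group as existence of trivial products\<close>

lemma add_self_eqD: "a + a = a \<Longrightarrow> a = (0 :: 'a :: group_add)"
  by (metis add_left_cancel add_0_right)

lemma add_eq_0_swap:
  assumes "a + b = 0"
  shows "b + a = (0 :: 'a :: group_add)"
proof -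
  have "b = - a" using minus_unique[OF assms] by simp
  then show ?thesis by simp
qed

text \<open>The identity of the semigroup is idempotent, hence trivial in the free groups, so an
  inverse of \<open>t\<close> completes it to a trivial product.\<close>

lemma trivial_product_if_group:
  assumes "semigroup_is_group (gen_semigroup (generator P ` T))" and "t \<in> T"
  shows "\<exists>ts. set ts \<subseteq> T \<and> prod_val P (t # ts) = prod_val P []"
proof -
  obtain e where e: "group \<lparr>carrier = gen_semigroup (generator P ` T), monoid.mult = fg2_mult, one
      = e\<rparr>"
    using assms(1) by (auto simp: semigroup_is_group_def)
  interpret G: group "\<lparr>carrier = gen_semigroup (generator P ` T), monoid.mult = fg2_mult, one = e\<rparr>"
    by (rule e)
  have "e \<in> gen_semigroup (generator P ` T)" and ee: "fg2_mult e e = e"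
    using G.one_closed G.r_one[OF G.one_closed] by simp_all
  then obtain es where es: "e = prod_val P es" unfolding gen_semigroup_generator by blast
  have "prod_val P (es @ es) = prod_val P es" using ee by (simp add: es prod_val_append)
  then have "e = prod_val P []"
    by (auto simp: es prod_val_eq_iff phi_append mk_append phi_Nil dest!: add_self_eqD)
  have t: "prod_val P [t] \<in> gen_semigroup (generator P ` T)" using assms(2) by (simp add:
      prod_val_single gs_base)
  obtain y where "y \<in> gen_semigroup (generator P ` T)" "fg2_mult (prod_val P [t]) y = e"
    using G.r_inv_ex[of "prod_val P [t]"] t by auto
  then obtain ys where "set ys \<subseteq> T" "fg2_mult (prod_val P [t]) (prod_val P ys) = e"
    unfolding gen_semigroup_generator by blast
  then show ?thesis using \<open>e = prod_val P []\<close> by (auto simp: prod_val_append)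
qed

text \<open>If \<open>us @ t # vs\<close> is trivial, so is its rotation
  \<open>vs @ us @ [t]\<close>, and \<open>vs @ us\<close> represents the inverse of
  \<open>t\<close>.\<close>

lemma group_if_trivial_product:
  assumes "set ts = T" "ts \<noteq> []" "prod_val P ts = prod_val P []"
  shows "semigroup_is_group (gen_semigroup (generator P ` T))"
proof -
  let ?S = "gen_semigroup (generator P ` T)"
  have S: "x \<in> ?S \<longleftrightarrow> (\<exists>ts. x = prod_val P ts \<and> ts \<noteq> [] \<and> set ts \<subseteq> T)" for x
    by (auto simp: gen_semigroup_generator)
  have one: "prod_val P [] \<in> ?S" unfolding S by (rule exI[of _ ts]) (use assms in auto)
  have l1: "fg2_mult (prod_val P []) x = x" if "x \<in> ?S" for x
    using that by (auto simp: S prod_val_append)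
  have assoc: "fg2_mult (fg2_mult x y) w = fg2_mult x (fg2_mult y w)"
    if "x \<in> ?S" "y \<in> ?S" "w \<in> ?S" for x y w
    using that by (auto simp: S prod_val_append)
  have inv: "\<exists>y\<in>?S. fg2_mult y x = prod_val P []" if "x \<in> ?S" for x
    using that
  proof induction
    case (gs_base x)
    then obtain t where t: "t \<in> T" "x = prod_val P [t]" by (auto simp: prod_val_single)
    then obtain us vs where uv: "ts = us @ t # vs" using assms(1) by (metis split_list)
    have "prod_val P ((vs @ us) @ [t]) = prod_val P []"
    proof -
      have "mk (W1 P (us @ [t])) + mk (W1 P vs) = 0"
        "mk (W2 (length P) (us @ [t])) + mk (W2 (length P) vs) = 0"
        using assms(3) by (simp_all add: prod_val_Nil_iff uv mk_append add.assoc)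
      from this[THEN add_eq_0_swap] show ?thesis
        by (simp add: prod_val_Nil_iff mk_append add.assoc)
    qed
    \<comment> \<open>An empty \<open>vs @ us\<close> is no element by itself, but its value is also
      that of the nonempty \<open>ts\<close>.\<close>
    moreover have "prod_val P (vs @ us) \<in> ?S"
    proof (cases "vs @ us = []")
      case True
      then show ?thesis using one by (simp del: append_is_Nil_conv)
    next
      case False
      then show ?thesis unfolding S using uv assms(1) by (intro exI[of _ "vs @ us"]) auto
    qed
    ultimately show ?case using t by (intro bexI[of _ "prod_val P (vs @ us)"]) (simp_all add:
        prod_val_append)
  next
    case (gs_mult x y)
    then obtain x' y' where x': "x' \<in> ?S" "fg2_mult x' x = prod_val P []"
      and y': "y' \<in> ?S" "fg2_mult y' y = prod_val P []" by blast
    have "fg2_mult (fg2_mult y' x') (fg2_mult x y) = fg2_mult y' (fg2_mult (fg2_mult x' x) y)"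
      using gs_mult(1,2) x'(1) y'(1) by (simp add: assoc gen_semigroup.gs_mult)
    also have "\<dots> = prod_val P []" by (simp add: x' y' l1 gs_mult(2))
    finally show ?case using gen_semigroup.gs_mult[OF y'(1) x'(1)] by blast
  qed
  have "group \<lparr>carrier = ?S, monoid.mult = fg2_mult, one = prod_val P []\<rparr>"
    by (rule groupI) (use one l1 assoc inv in \<open>auto intro: gen_semigroup.gs_mult\<close>)
  then show ?thesis unfolding semigroup_is_group_def by blast
qed

theorem group_iff_solvable:
  assumes "length P = n" "3 \<le> n"
  shows "semigroup_is_group (gen_semigroup (generator P ` set (toks n))) \<longleftrightarrow> rpcp_solvable P"
proof
  assume g: "semigroup_is_group (gen_semigroup (generator P ` set (toks n)))"
  have TD: "TD i \<in> set (toks n) \<longleftrightarrow> i < 6" for i by (auto simp: set_toks)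
  then have TD0: "TD 0 \<in> set (toks n)" by simp
  obtain ts where ts: "set ts \<subseteq> set (toks n)" "prod_val P (TD 0 # ts) = prod_val P []"
    using trivial_product_if_group[OF g TD0] by blast
  have sub: "set (TD 0 # ts) \<subseteq> set (toks n)" using ts(1) TD0 by simp
  then have six: "\<forall>i. TD i \<in> set (TD 0 # ts) \<longrightarrow> i < 6" using TD by blast
  have 0: "mk (W1 P (TD 0 # ts)) = 0" "mk (W2 n (TD 0 # ts)) = 0" "TD 0 \<in> set (TD 0 # ts)"
    using ts(2) unfolding prod_val_Nil_iff assms(1) by simp_all
  obtain z where z: "set z \<subseteq> set (TD 0 # ts)" "\<forall>k. TD k \<notin> set z"
    "mk (pos_word (fst (P ! 0)) @ W1 P z @ winv (pos_word (snd (P ! 0)))) = 0"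
    "mk ([(True, 0)] @ W2 n z @ [(False, 1)]) = 0"
    using ex_check_segment[OF 0 six] by blast
  show "rpcp_solvable P"
    by (rule check_segment[OF assms subset_trans[OF z(1) sub] z(2-4)])
next
  assume "rpcp_solvable P"
  then obtain ts where ts: "set ts = set (toks n)" "mk (W1 P ts) = 0" "mk (W2 n ts) = 0"
    using ex_trivial_product[OF assms] by blast
  have "TC \<in> set ts" unfolding ts(1) set_toks by simp
  then have "ts \<noteq> []" by auto
  with ts show "semigroup_is_group (gen_semigroup (generator P ` set (toks n)))"
    by (intro group_if_trivial_product[of ts]) (simp_all add: prod_val_Nil_iff assms(1))
qed

section \<open>Computability of the reduction\<close>

text \<open>Only codes of lists with \<open>n\<close> pairs are constrained; elsewhere the total
  function \<open>h\<close> is free.\<close>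

definition pcp_computable :: "nat \<Rightarrow> ((gen list \<times> gen list) list \<Rightarrow> nat) \<Rightarrow> bool" where
  "pcp_computable n F \<longleftrightarrow> (\<exists>h. computable h \<and> (\<forall>P. length P = n \<longrightarrow> h (enc_pcp_instance P) = F P))"

definition word_computable :: "nat \<Rightarrow> ((gen list \<times> gen list) list \<Rightarrow> fword) \<Rightarrow> bool" where
  "word_computable n W \<longleftrightarrow> pcp_computable n (\<lambda>P. list_encode (map enc_letter (W P)))"

lemma pcp_computableI: "computable h \<Longrightarrow> (\<And>P. length P = n \<Longrightarrow> h (enc_pcp_instance P) = F P) \<Longrightarrow>
    pcp_computable n F"
  unfolding pcp_computable_def by blast

lemma pcp_computableE:
  assumes "pcp_computable n F"
  obtains h where "computable h" "\<And>P. length P = n \<Longrightarrow> h (enc_pcp_instance P) = F P"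
  using assms unfolding pcp_computable_def by blast

lemma pcp_computable_cong: "pcp_computable n F \<Longrightarrow> (\<And>P. length P = n \<Longrightarrow> F P = G P) \<Longrightarrow> pcp_computable n
    G"
  unfolding pcp_computable_def by auto

lemma word_computable_cong: "word_computable n V \<Longrightarrow> (\<And>P. length P = n \<Longrightarrow> V P = W P) \<Longrightarrow>
    word_computable n W"
  unfolding word_computable_def by (erule pcp_computable_cong) simp

lemma pcp_computable_pair:
  assumes "pcp_computable n F" "pcp_computable n G"
  shows "pcp_computable n (\<lambda>P. prod_encode (F P, G P))"
proof -
  obtain h where "computable h" "\<And>P. length P = n \<Longrightarrow> h (enc_pcp_instance P) = F P"
    using assms(1) by (rule pcp_computableE) (rule that)
  moreover obtain g where "computable g" "\<And>P. length P = n \<Longrightarrow> g (enc_pcp_instance P) = G P"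
    using assms(2) by (rule pcp_computableE) (rule that)
  ultimately show ?thesis by (intro pcp_computableI[OF computable2_comp[OF
      computable2_prod_encode, of h g]]) simp_all
qed

lemma pcp_computable_list:
  "(\<And>t. t \<in> set ts \<Longrightarrow> pcp_computable n (F t)) \<Longrightarrow> pcp_computable n (\<lambda>P. list_encode (map (\<lambda>t. F t P)
      ts))"
proof (induction ts)
  case Nil
  show ?case by (rule pcp_computableI[OF computable_const]) simp
next
  case (Cons t ts)
  have "pcp_computable n (F t)" and ts: "pcp_computable n (\<lambda>P. list_encode (map (\<lambda>t. F t P) ts))"
    using Cons by simp_all
  from this(1) obtain h where h: "computable h" "\<And>P. length P = n \<Longrightarrow> h (enc_pcp_instance P) = F t P"
    by (rule pcp_computableE) (rule that)
  from ts obtain g where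
    g: "computable g" "\<And>P. length P = n \<Longrightarrow> g (enc_pcp_instance P) = list_encode (map (\<lambda>t. F t P) ts)"
    by (rule pcp_computableE) (rule that)
  show ?case
    by (rule pcp_computableI[OF computable_lcons[OF h(1) g(1)]]) (simp add: h g del:
        list_encode.simps)
qed

lemma word_computable_append_const:
  assumes "word_computable n W"
  shows "word_computable n (\<lambda>P. c @ W P)"
proof -
  obtain h where h: "computable h"
    "\<And>P. length P = n \<Longrightarrow> h (enc_pcp_instance P) = list_encode (map enc_letter (W P))"
    using assms unfolding word_computable_def by (rule pcp_computableE) (rule that)
  show ?thesis
    unfolding word_computable_def by (rule pcp_computableI[OF computable_prepend[OF h(1), of "map
        enc_letter c"]]) (simp add: h)
qed

lemma word_computable_Nil: "word_computable n (\<lambda>P. [])"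
  unfolding word_computable_def by (rule pcp_computableI[OF computable_const]) simp

lemma word_computable_const: "word_computable n (\<lambda>P. c)"
  using word_computable_append_const[OF word_computable_Nil] by simp

lemma ltl_funpow: "i \<le> length xs \<Longrightarrow> (ltl ^^ i) (list_encode xs) = list_encode (drop i xs)"
proof (induction i)
  case (Suc i)
  then have "drop i xs = xs ! i # drop (Suc i) xs" by (simp add: Cons_nth_drop_Suc)
  then show ?case using Suc by (simp del: list_encode.simps)
qed simp

section \<open>Computing the images of the input words\<close>

definition pcp_entry :: "nat \<Rightarrow> nat \<Rightarrow> nat" where
  "pcp_entry i x = lhd ((ltl ^^ i) x)"

lemma computable_pcp_entry: "computable (pcp_entry i)"
  unfolding pcp_entry_def[abs_def] by (intro computable_comp[OF computable_lhd] computable_iter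
      computable_ltl computable_const computable_id)

lemma pcp_entry_enc:
  assumes "i < length P"
  shows "prod_decode (pcp_entry i (enc_pcp_instance P)) =
    (list_encode (map enc_gen (fst (P ! i))), list_encode (map enc_gen (snd (P ! i))))"
proof -
  obtain u v where uv: "P ! i = (u, v)" by fastforce
  have "drop i P = P ! i # drop (Suc i) P" using assms by (simp add: Cons_nth_drop_Suc)
  then show ?thesis using assms
    by (simp add: pcp_entry_def enc_pcp_instance_def ltl_funpow drop_map uv del: list_encode.simps)
qed

lemma yw_gen_index: "yw (gen_index g) = (case g of GA \<Rightarrow> [(False, GA), (False, GB)] | GB \<Rightarrow> [(False,
    GB), (False, GA)])"
  by (auto simp: yw_def apow_def gen_index_def split: gen.splits)

lemma enc_phi_pos_word:
  "map enc_letter (phi (pos_word u)) = concat (map (\<lambda>x. if x = 0 then [0, 1] else [1, 0]) (map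
      enc_gen u))"
  by (induction u) (auto simp: phi_def pos_word_def yw_gen_index enc_letter_def enc_gen_def split:
      gen.splits)

text \<open>Inversion adds 2 to a letter code and reverses, so the inverses of ab and ba are
  \<open>[3, 2]\<close> and \<open>[2, 3]\<close>.\<close>

lemma enc_phi_neg:
  "map enc_letter (phi (winv (pos_word u))) =
     concat (map (\<lambda>x. if x = 0 then [3, 2] else [2, 3]) (rev (map enc_gen u)))"
  by (induction u)
    (auto simp: phi_def pos_word_def yw_gen_index winv_Cons enc_letter_def enc_gen_def split:
        gen.splits)

lemma push_rev:
  "push [0] [1] (list_encode (map enc_gen u)) 0 = list_encode (rev (map enc_gen u))"
proof -
  have "concat (map (\<lambda>x. if x = 0 then [0] else [1]) (map enc_gen w)) = map enc_gen w" for w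
    by (induction w) (auto simp: enc_gen_def split: gen.splits)
  then show ?thesis
    using push_list_encode[of "[0]" "[1]" "map enc_gen u" "[]"]
    unfolding rev_map append_Nil2 list_encode.simps(1) by (simp only:)
qed

lemma word_computable_append_code:
  assumes "word_computable n W" and "i < n" and sel: "sel = fst \<or> sel = snd"
  shows "word_computable n (\<lambda>P. phi (pos_word (sel (P ! i))) @ W P)"
    and "word_computable n (\<lambda>P. phi (winv (pos_word (sel (P ! i)))) @ W P)"
proof -
  obtain h where h: "computable h"
    "\<And>P. length P = n \<Longrightarrow> h (enc_pcp_instance P) = list_encode (map enc_letter (W P))"
    using assms(1) unfolding word_computable_def by (rule pcp_computableE) (rule that)
  obtain e where e: "computable e" "\<And>P. length P = n \<Longrightarrow> e (enc_pcp_instance P) = list_encode (map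
      enc_gen (sel (P ! i)))"
  proof (cases "sel = fst")
    case True
    show ?thesis
      by (rule that[OF computable_comp[OF computable_fst_decode computable_pcp_entry[of i]]]) (use
          assms(2) True in \<open>simp add: pcp_entry_enc\<close>)
  next
    case False
    then have "sel = snd" using sel by simp
    show ?thesis
      by (rule that[OF computable_comp[OF computable_snd_decode computable_pcp_entry[of i]]])
        (use assms(2) \<open>sel = snd\<close> in \<open>simp add: pcp_entry_enc\<close>)
  qed
  \<comment> \<open>Two passes: \<open>push_rev\<close> reverses the code of the word before letters
    are substituted.\<close>
  show "word_computable n (\<lambda>P. phi (pos_word (sel (P ! i))) @ W P)"
    unfolding word_computable_def
    by (rule pcp_computableI[OF computable_push[OF computable_push[OF e(1) computable_const, of
        "[0]" "[1]" 0] h(1), of "[0, 1]" "[1, 0]"]])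
      (simp only: h e push_rev push_list_encode enc_phi_pos_word rev_rev_ident map_append)
  show "word_computable n (\<lambda>P. phi (winv (pos_word (sel (P ! i)))) @ W P)"
    unfolding word_computable_def
    by (rule pcp_computableI[OF computable_push[OF e(1) h(1), of "[3, 2]" "[2, 3]"]])
      (simp add: h e push_list_encode enc_phi_neg)
qed

lemmas word_computable_code = word_computable_append_code[OF word_computable_Nil, simplified]

lemma fst_phi_pos_word: "x \<in> set (phi (pos_word u)) \<Longrightarrow> fst x = False"
  by (induction u) (auto simp: phi_def pos_word_def yw_gen_index split: gen.splits)

lemma fst_phi_neg: "x \<in> set (phi (winv (pos_word u))) \<Longrightarrow> fst x = True"
  by (induction u) (auto simp: phi_def pos_word_def yw_gen_index winv_Cons split: gen.splits)

lemma nf_phi_pos_word: "nf (phi (pos_word u)) = phi (pos_word u)" "nf (phi (winv (pos_word u))) =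
    phi (winv (pos_word u))"
  using fst_phi_pos_word fst_phi_neg by (blast intro!: nf_irr irr_pos_word)+

definition barrier_pair :: "nat \<Rightarrow> fword" where
  "barrier_pair k = nf (phi [(True, barrier k), (False, barrier (next_type k))])"

text \<open>The reduced pair starts with an inverse letter and ends with a positive one, so a
  negative word before it or a positive word after it does not cancel.\<close>

lemma barrier_pair_ends:
  assumes "k < 6"
  shows "barrier_pair k \<noteq> [] \<and> fst (hd (barrier_pair k)) \<and> \<not> fst (last (barrier_pair k))"
proof -
  have yw_barrier: "yw (barrier j) = replicate (Suc j) (True, GA) @ [(False, GB)] @ replicate (Suc
      (Suc j)) (False, GA)"
    for j
  proof -
    have "nat (1 + int j) = Suc j" "nat (2 + int j) = Suc (Suc j)" by simp_all
    then show ?thesis by (simp add: yw_def apow_def barrier_def)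
  qed
  have next_type: "next_type 0 = Suc 0" "next_type (Suc 0) = 2" "next_type 2 = 3" "next_type 3 =
      4" "next_type 4 = 5" "next_type 5 = 0"
    by (simp_all add: next_type_def)
  have barrier_pair: "barrier_pair k = nf (winv (yw (barrier k)) @ yw (barrier (next_type k)))"
    by (simp add: barrier_pair_def phi_def)
  consider "k = 0" | "k = Suc 0" | "k = 2" | "k = 3" | "k = 4" | "k = 5" using assms by linarith
  then show ?thesis
    unfolding barrier_pair yw_barrier by cases (simp_all only: next_type, simp_all add: nf_def
        winv_def numeral_eq_Suc)
qed

lemma nf_phi_TD:
  assumes "k < 6"
  shows "nf (phi (L1 P (TD k))) = phi (exit1 P k) @ barrier_pair k @ phi (entry1 P (next_type k))"
proof -
  have ex: "fst x" if "x \<in> set (phi (exit1 P k))" for x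
    using that fst_phi_neg by (auto simp: exit1_def phi_Nil split: if_splits)
  have en: "\<not> fst x" if "x \<in> set (phi (entry1 P j))" for x j
    using that fst_phi_pos_word by (auto simp: entry1_def phi_Nil split: if_splits)
  have "irr (phi (exit1 P k))" by (rule irr_pos_word[of _ True]) (simp add: ex)
  moreover have "irr (phi (entry1 P (next_type k)))" by (rule irr_pos_word[of _ False]) (simp add:
      en)
  moreover have "irr (barrier_pair k)" by (simp add: barrier_pair_def)
  moreover have "fst (last (phi (exit1 P k)))" if "phi (exit1 P k) \<noteq> []" using ex[OF
      last_in_set[OF that]] .
  moreover have "\<not> fst (hd (phi (entry1 P (next_type k))))" if "phi (entry1 P (next_type k)) \<noteq> []"
      using en[OF hd_in_set[OF that]] .
  ultimately have "irr (phi (exit1 P k) @ barrier_pair k @ phi (entry1 P (next_type k)))"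
    using barrier_pair_ends[OF assms] unfolding irr_append by (auto simp: ilet_def)
  moreover have "mk (phi (L1 P (TD k))) = mk (phi (exit1 P k) @ barrier_pair k @ phi (entry1 P
      (next_type k)))"
    unfolding L1.simps phi_append barrier_pair_def mk_append mk_nf ..
  ultimately show ?thesis by (simp add: mk_eq_iff nf_irr)
qed

lemma word_computable_generator:
  assumes "3 \<le> n" "t \<in> set (toks n)"
  shows "word_computable n (\<lambda>P. nf (phi (L1 P t)))"
proof (cases t)
  case (TA i)
  then show ?thesis using assms word_computable_code(1)[of i n fst] by (auto simp: set_toks
      nf_phi_pos_word)
next
  case (TB i)
  then show ?thesis using assms word_computable_code(2)[of i n snd] by (auto simp: set_toks
      nf_phi_pos_word)
next
  case (TR i)
  then show ?thesis using assms word_computable_code(2)[of i n fst] by (auto simp: set_toks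
      nf_phi_pos_word)
next
  case (TS i)
  then show ?thesis using assms word_computable_code(1)[of i n snd] by (auto simp: set_toks
      nf_phi_pos_word)
next
  case TC
  have "word_computable n (\<lambda>P. phi (pos_word (fst (P ! (n - 1)))))" using assms
      word_computable_code(1)[of "n - 1" n fst] by simp
  then show ?thesis by (rule word_computable_cong) (simp add: TC nf_phi_pos_word)
next
  case (TD k)
  then have k: "k < 6" using assms by (auto simp: set_toks)
  have en: "word_computable n (\<lambda>P. phi (entry1 P j))" for j
    using assms word_computable_code(1)[of 0 n fst] word_computable_Nil by (cases "j < 4")
        (simp_all add: entry1_def phi_Nil)
  have "word_computable n (\<lambda>P. phi (exit1 P k) @ barrier_pair k @ phi (entry1 P (next_type k)))"
    using assms word_computable_append_code(2)[OF word_computable_append_const[OF en], of 0 snd]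
        word_computable_append_const[OF en]
    by (cases "k < 4") (simp_all add: exit1_def phi_Nil)
  then show ?thesis by (simp only: TD nf_phi_TD[OF k])
qed (simp_all add: word_computable_const)

text \<open>Only the first components depend on the instance; the second ones are constants for
  fixed \<open>n\<close>, with their reduced forms hard-wired.\<close>

lemma pcp_computable_reduction:
  assumes "3 \<le> n"
  shows "pcp_computable n (\<lambda>P. enc_fg_instance (map (generator P) (toks n)))"
proof -
  let ?F = "\<lambda>t P. prod_encode (list_encode (map enc_letter (nf (phi (L1 P t)))), list_encode (map
      enc_letter (nf (phi (L2 n t)))))"
  have "pcp_computable n (\<lambda>P. list_encode (map (\<lambda>t. ?F t P) (toks n)))"
    by (rule pcp_computable_list) (rule pcp_computable_pair, use word_computable_generator[OF
        assms] word_computable_const in \<open>auto simp: word_computable_def\<close>)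
  then show ?thesis
    by (rule pcp_computable_cong) (simp add: enc_fg_instance_def generator_def comp_def)
qed

lemma reduced_iff_irr: "reduced w \<longleftrightarrow> irr w"
proof -
  have "inv_letter = ilet" by (auto simp: inv_letter_def ilet_def)
  then show ?thesis by (simp add: reduced_def irr_def successively_conv_nth)
qed

lemma RPCP_reduces_to_GROUP:
  assumes "3 \<le> n" and "RPCP_undecidable n"
  shows "GROUP_undecidable (8 * (n - 1))"
proof (rule ccontr)
  assume "\<not> GROUP_undecidable (8 * (n - 1))"
  then obtain f where f: "\<And>Q. fg_instance Q \<Longrightarrow> length Q = 8 * (n - 1) \<Longrightarrow>
      eval f [enc_fg_instance Q] (if group_problem Q then 1 else 0)"
    unfolding GROUP_undecidable_def decidable_on_def by auto
  obtain h where "computable h" and h: "\<And>P. length P = n \<Longrightarrow>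
      h (enc_pcp_instance P) = enc_fg_instance (map (generator P) (toks n))"
    using pcp_computable_reduction[OF assms(1)] by (rule pcp_computableE) (rule that)
  then obtain g where g: "\<And>x. eval g [x] (h x)" by (auto simp: computable_def)
  have "eval (Comp 1 f [g]) [enc_pcp_instance P] (if rpcp_solvable P then 1 else 0)" if n: "length
      P = n" for P
  proof -
    let ?Q = "map (generator P) (toks n)"
    have "fg_instance ?Q"
      by (auto simp: fg_instance_def generator_def reduced_iff_irr)
    moreover have "length ?Q = 8 * (n - 1)" using length_toks[OF assms(1)] by simp
    moreover have "group_problem ?Q \<longleftrightarrow> rpcp_solvable P"
      using group_iff_solvable[OF n assms(1)] by (simp add: group_problem_def)
    ultimately have "eval f [h (enc_pcp_instance P)] (if rpcp_solvable P then 1 else 0)"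
      using f[of ?Q] h[OF n] by simp
    then show ?thesis by (intro eval_Comp1[OF _ g]) simp_all
  qed
  then show False
    using assms(2) unfolding RPCP_undecidable_def decidable_on_def by auto
qed

theorem mainTheorem5:
  assumes known_RPCP7: "RPCP_undecidable 7"
  shows "GROUP_undecidable_general \<and> GROUP_undecidable 48 \<and>
         (\<forall>n\<ge>3. RPCP_undecidable n \<longrightarrow> GROUP_undecidable (8 * (n - 1)))"
proof -
  have 48: "GROUP_undecidable 48"
    using RPCP_reduces_to_GROUP[OF _ known_RPCP7] by simp
  \<comment> \<open>A decider for all instances would in particular decide those of length
    48.\<close>
  then have "GROUP_undecidable_general"
    unfolding GROUP_undecidable_def GROUP_undecidable_general_def decidable_on_def by blast
  with 48 show ?thesis using RPCP_reduces_to_GROUP by blast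
qed

end
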